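(* Let $d\ge 3$. The differential operator $L_{d-1,F}$ of order $d-1$, which annihilates the generating function $F_d(z)=\sum_{n\ge0}x_n^{(d)}z^n$, is irreducible over $\mathbb{C}(z)\langle D\rangle$: it cannot be written as $L_{d-1,F}=AB$ with $A,B\in\mathbb{C}(z)\langle D\rangle$ both of order at least $1$.
   Context: $x_n^{(d)}=\sum_{n_1+\dots+n_d=n}\frac{(n!)^2}{(n_1!\cdots n_d!)^2}$ (sum over nonnegative integers). $\mathbb{C}(z)\langle D\rangle$ is the ring of linear differential operators with rational function coefficients, $D=d/dz$, $Dz=zD+1$. The operator $L_{d-1,F}$ is the following. In the ring $\mathbb{C}[t]\langle\theta\rangle$ with $\theta=t\,\frac{d}{dt}$ (so $\theta t=t(\theta+1)$), define $P_{d,0}=1$, $P_{d,1}=\theta$, and $P_{d,n+1}=\theta P_{d,n}-n(d-n+1)\,t\,P_{d,n-1}$ for $1\le n\le d$. Let $r=\lfloor\frac{d+1}{2}\rfloor$ and write $P_{d,d+1}=\sum_{m=0}^{r}t^mR_m^B(\theta)$ with polynomials $R_m^B$. Put $R_0(\theta)=\theta^{d-1}$ and $R_k(\theta)=R_k^B(\theta)\prod_{j=1}^{k-1}(\theta+j)^2$ for $1\le k\le r$. Then, now with $\theta=zD$, $L_{d-1,F}$ is defined by $z\,L_{d-1,F}=\sum_{k=0}^rz^kR_k(\theta)$. *)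

theory Defs
  imports Complex_Main
    "HOL-Computational_Algebra.Field_as_Ring"
    "HOL-Computational_Algebra.Polynomial_Factorial"
    "HOL-Computational_Algebra.Polynomial_FPS"
    "HOL-Computational_Algebra.Formal_Laurent_Series"
begin

section \<open>Rational functions and their derivation\<close>

type_synonym ratfun = "complex poly fract"

abbreviation ratfun_var :: ratfun where
  "ratfun_var \<equiv> to_fract [:0, 1:]"

text \<open>The quotient rule, applied to the reduced fraction; see \<open>ratfun_deriv_Fract\<close>.\<close>

definition ratfun_deriv :: "ratfun \<Rightarrow> ratfun" where
  "ratfun_deriv x = (case quot_of_fract x of (a, b) \<Rightarrow>
     Fraction_Field.Fract (pderiv a * b - a * pderiv b) (b * b))"

lemma quot_of_fract_cases:
  fixes a b :: "complex poly"
  assumes "b \<noteq> 0"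
  obtains c d where "quot_of_fract (Fraction_Field.Fract a b) = (c, d)" "d \<noteq> 0" "a * d = c * b"
proof -
  obtain c d where cd: "quot_of_fract (Fraction_Field.Fract a b) = (c, d)" by fastforce
  have "d \<noteq> 0" using snd_quot_of_fract_nonzero[of "Fraction_Field.Fract a b"] cd by simp
  moreover have "Fraction_Field.Fract c d = Fraction_Field.Fract a b"
    using quot_to_fract_quot_of_fract[of "Fraction_Field.Fract a b"] cd
    by (simp add: quot_to_fract_def)
  ultimately show ?thesis using that[OF cd] assms by (simp add: eq_fract)
qed

lemma ratfun_deriv_Fract:
  assumes "b \<noteq> 0"
  shows "ratfun_deriv (Fraction_Field.Fract a b)
    = Fraction_Field.Fract (pderiv a * b - a * pderiv b) (b * b)"
proof -
  obtain c d where cd: "quot_of_fract (Fraction_Field.Fract a b) = (c, d)" "d \<noteq> 0"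
    and e: "a * d = c * b" using assms by (rule quot_of_fract_cases)
  have e': "pderiv a * d = pderiv c * b + c * pderiv b - a * pderiv d"
    using arg_cong[OF e, of pderiv] by (simp add: pderiv_mult algebra_simps)
  have "(pderiv a * b - a * pderiv b) * (d * d)
      = b * d * (pderiv a * d) - pderiv b * (a * d) * d"
    by (simp add: algebra_simps)
  also have "\<dots> = b * d * (pderiv c * b) + b * d * (c * pderiv b) - b * pderiv d * (a * d)
        - pderiv b * (a * d) * d"
    unfolding e' by (simp add: algebra_simps)
  also have "\<dots> = (pderiv c * d - c * pderiv d) * (b * b)"
    unfolding e by (simp add: algebra_simps)
  finally show ?thesis using assms cd(2) by (simp add: ratfun_deriv_def cd(1) eq_fract)
qed

lemma ratfun_deriv_to_fract [simp]: "ratfun_deriv (to_fract p) = to_fract (pderiv p)"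
  by (simp add: to_fract_def ratfun_deriv_Fract)

lemma ratfun_deriv_0 [simp]: "ratfun_deriv 0 = 0"
  using ratfun_deriv_to_fract[of 0] by (simp del: ratfun_deriv_to_fract)

lemma ratfun_deriv_1 [simp]: "ratfun_deriv 1 = 0"
  using ratfun_deriv_to_fract[of 1] by (simp del: ratfun_deriv_to_fract)

lemma ratfun_deriv_add: "ratfun_deriv (x + y) = ratfun_deriv x + ratfun_deriv y"
  by (cases x; cases y)
     (simp add: ratfun_deriv_Fract eq_fract pderiv_add pderiv_mult algebra_simps)

lemma ratfun_deriv_mult: "ratfun_deriv (x * y) = ratfun_deriv x * y + x * ratfun_deriv y"
  by (cases x; cases y)
     (simp add: ratfun_deriv_Fract eq_fract pderiv_add pderiv_mult algebra_simps)


section \<open>The ring of differential operators over the rational functions\<close>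

text \<open>
  An operator \<open>\<Sum>i. a\<^sub>i D^i\<close> is encoded by the polynomial whose \<open>i\<close>-th
  coefficient is \<open>a\<^sub>i\<close>; only the additive structure is the one of polynomials.
\<close>

typedef diffop = "UNIV :: ratfun poly set"
  morphisms diffop_poly Diffop by simp

setup_lifting type_definition_diffop

lemma Diffop_diffop_poly [simp]: "Diffop (diffop_poly A) = A"
  by (rule diffop_poly_inverse)

lemma diffop_poly_Diffop [simp]: "diffop_poly (Diffop p) = p"
  by (rule Diffop_inverse) simp

text \<open>Left multiplication by \<open>D\<close>, using \<open>D a = a D + a'\<close>.\<close>

definition D_left :: "ratfun poly \<Rightarrow> ratfun poly" where
  "D_left q = pCons 0 q + map_poly ratfun_deriv q"

definition skew_times :: "ratfun poly \<Rightarrow> ratfun poly \<Rightarrow> ratfun poly" where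
  "skew_times p q = (\<Sum>i\<le>degree p. smult (coeff p i) ((D_left ^^ i) q))"

lemma map_deriv_add:
  "map_poly ratfun_deriv (p + q) = map_poly ratfun_deriv p + map_poly ratfun_deriv q"
  by (rule poly_eqI) (simp add: coeff_map_poly ratfun_deriv_add)

lemma map_deriv_smult:
  "map_poly ratfun_deriv (smult a p) = smult a (map_poly ratfun_deriv p) + smult (ratfun_deriv a) p"
  by (rule poly_eqI) (simp add: coeff_map_poly ratfun_deriv_mult algebra_simps)

lemma D_left_add: "D_left (p + q) = D_left p + D_left q"
  by (simp add: D_left_def map_deriv_add)

lemma D_left_0 [simp]: "D_left 0 = 0"
  by (simp add: D_left_def)

lemma D_left_smult: "D_left (smult a p) = smult a (D_left p) + smult (ratfun_deriv a) p"
  by (simp add: D_left_def map_deriv_smult smult_add_right algebra_simps)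

lemma D_left_pow_add: "(D_left ^^ n) (p + q) = (D_left ^^ n) p + (D_left ^^ n) q"
  by (induction n) (simp_all add: D_left_add)

lemma D_left_pow_0 [simp]: "(D_left ^^ n) 0 = 0"
  by (induction n) simp_all

lemma D_left_sum: "D_left (\<Sum>i\<in>I. f i) = (\<Sum>i\<in>I. D_left (f i))"
  by (induction I rule: infinite_finite_induct) (simp_all add: D_left_add)

lemma skew_times_bound:
  assumes "degree p \<le> n"
  shows "skew_times p q = (\<Sum>i\<le>n. smult (coeff p i) ((D_left ^^ i) q))"
  unfolding skew_times_def using assms
  by (intro sum.mono_neutral_left) (auto simp: coeff_eq_0)

lemma skew_add_left: "skew_times (p + q) r = skew_times p r + skew_times q r"
proof -
  let ?n = "max (degree p) (degree q)"
  have "degree (p + q) \<le> ?n" by (rule degree_add_le_max)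
  then show ?thesis
    by (simp add: skew_times_bound[of _ ?n] smult_add_left sum.distrib)
qed

lemma skew_add_right: "skew_times p (q + r) = skew_times p q + skew_times p r"
  by (simp add: skew_times_def D_left_pow_add smult_add_right sum.distrib)

lemma skew_0_left [simp]: "skew_times 0 q = 0"
  by (simp add: skew_times_def)

lemma skew_0_right [simp]: "skew_times p 0 = 0"
  by (simp add: skew_times_def)

lemma smult_sum_right: "smult a (\<Sum>i\<in>I. f i) = (\<Sum>i\<in>I. smult a (f i))"
  by (induction I rule: infinite_finite_induct) (simp_all add: smult_add_right)

lemma skew_smult_left: "skew_times (smult a p) q = smult a (skew_times p q)"
  by (simp add: skew_times_bound[of "smult a p" "degree p"] degree_smult_le
      skew_times_def[of p] smult_sum_right)

lemma skew_sum_left: "skew_times (\<Sum>i\<in>I. f i) q = (\<Sum>i\<in>I. skew_times (f i) q)"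
  by (induction I rule: infinite_finite_induct) (simp_all add: skew_add_left)

lemma skew_pCons_0: "skew_times (pCons 0 p) q = (\<Sum>i\<le>degree p. smult (coeff p i) ((D_left ^^ Suc i) q))"
proof -
  have "skew_times (pCons 0 p) q
      = (\<Sum>i\<le>Suc (degree p). smult (coeff (pCons 0 p) i) ((D_left ^^ i) q))"
    by (rule skew_times_bound) (simp add: degree_pCons_le)
  also have "\<dots> = (\<Sum>i\<le>degree p. smult (coeff p i) ((D_left ^^ Suc i) q))"
    by (subst sum.atMost_Suc_shift) simp
  finally show ?thesis .
qed

lemma degree_map_deriv: "degree (map_poly ratfun_deriv p) \<le> degree p"
  by (rule map_poly_degree_leq)

lemma skew_D_left: "skew_times (D_left p) q = D_left (skew_times p q)"
proof -
  have "skew_times (map_poly ratfun_deriv p) q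
      = (\<Sum>i\<le>degree p. smult (ratfun_deriv (coeff p i)) ((D_left ^^ i) q))"
    by (simp add: skew_times_bound[OF degree_map_deriv] coeff_map_poly)
  then show ?thesis
    by (simp add: D_left_def[of p] skew_add_left skew_pCons_0 skew_times_def[of p]
        D_left_sum D_left_smult sum.distrib)
qed

lemma skew_D_left_pow: "skew_times ((D_left ^^ n) p) q = (D_left ^^ n) (skew_times p q)"
  by (induction n) (simp_all add: skew_D_left)

lemma skew_assoc: "skew_times (skew_times p q) r = skew_times p (skew_times q r)"
proof -
  have "skew_times (skew_times p q) r
      = (\<Sum>i\<le>degree p. smult (coeff p i) (skew_times ((D_left ^^ i) q) r))"
    by (simp add: skew_times_def[of p q] skew_sum_left skew_smult_left)
  then show ?thesis by (simp add: skew_D_left_pow skew_times_def[of p "skew_times q r"])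
qed

lemma skew_1_left [simp]: "skew_times 1 q = q"
  by (simp add: skew_times_def)

lemma D_left_pow_1: "(D_left ^^ n) 1 = monom 1 n"
  by (induction n) (simp_all add: D_left_def map_poly_monom monom_Suc)

lemma skew_1_right [simp]: "skew_times p 1 = p"
  by (simp add: skew_times_def D_left_pow_1 smult_monom poly_as_sum_of_monoms)

instantiation diffop :: ring_1
begin

lift_definition zero_diffop :: diffop is 0 .
lift_definition one_diffop :: diffop is 1 .
lift_definition plus_diffop :: "diffop \<Rightarrow> diffop \<Rightarrow> diffop" is "(+)" .
lift_definition minus_diffop :: "diffop \<Rightarrow> diffop \<Rightarrow> diffop" is "(-)" .
lift_definition uminus_diffop :: "diffop \<Rightarrow> diffop" is uminus .
lift_definition times_diffop :: "diffop \<Rightarrow> diffop \<Rightarrow> diffop" is skew_times .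

instance
  by (standard; transfer) (simp_all add: skew_assoc skew_add_left skew_add_right)

end

definition diffop_order :: "diffop \<Rightarrow> nat" where
  "diffop_order A = degree (diffop_poly A)"

definition of_ratfun :: "ratfun \<Rightarrow> diffop" where
  "of_ratfun a = Diffop [:a:]"

definition D_op :: diffop where
  "D_op = Diffop [:0, 1:]"

abbreviation z_op :: diffop where
  "z_op \<equiv> of_ratfun ratfun_var"

lemma diffop_eqI: "diffop_poly A = diffop_poly B \<Longrightarrow> A = B"
  by (simp add: diffop_poly_inject)

lemma diffop_poly_of_ratfun [simp]: "diffop_poly (of_ratfun a) = [:a:]"
  by (simp add: of_ratfun_def)

lemma diffop_poly_D_op [simp]: "diffop_poly D_op = [:0, 1:]"
  by (simp add: D_op_def)

lemmas diffop_poly_simps =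
  zero_diffop.rep_eq one_diffop.rep_eq plus_diffop.rep_eq minus_diffop.rep_eq
  uminus_diffop.rep_eq times_diffop.rep_eq

lemma of_ratfun_0 [simp]: "of_ratfun 0 = 0"
  by (rule diffop_eqI) (simp add: diffop_poly_simps)

lemma of_ratfun_1 [simp]: "of_ratfun 1 = 1"
  by (rule diffop_eqI) (simp add: diffop_poly_simps one_pCons)

lemma of_ratfun_add: "of_ratfun (a + b) = of_ratfun a + of_ratfun b"
  by (rule diffop_eqI) (simp add: diffop_poly_simps)

lemma of_ratfun_mult: "of_ratfun (a * b) = of_ratfun a * of_ratfun b"
  by (rule diffop_eqI) (simp add: diffop_poly_simps skew_times_def)

lemma of_ratfun_power: "of_ratfun (a ^ n) = of_ratfun a ^ n"
  by (induction n) (simp_all add: of_ratfun_mult)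

lemma D_op_of_ratfun: "D_op * of_ratfun a = of_ratfun a * D_op + of_ratfun (ratfun_deriv a)"
  by (rule diffop_eqI) (simp add: diffop_poly_simps skew_times_def D_left_def map_poly_pCons)

lemma D_op_z_op: "D_op * z_op = z_op * D_op + 1"
  by (simp add: D_op_of_ratfun pderiv_pCons flip: one_pCons)

lemma diffop_expansion:
  "A = (\<Sum>i\<le>diffop_order A. of_ratfun (coeff (diffop_poly A) i) * D_op ^ i)"
proof -
  have pow: "diffop_poly (D_op ^ i) = monom 1 i" for i
  proof (induction i)
    case (Suc i)
    then show ?case
      by (simp add: times_diffop.rep_eq diffop_poly_D_op skew_times_def D_left_def map_poly_monom
          monom_Suc)
  qed (simp add: one_diffop.rep_eq)
  have sum: "diffop_poly (\<Sum>i\<in>I. f i) = (\<Sum>i\<in>I. diffop_poly (f i))" if "finite I"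
    for I :: "nat set" and f
    using that by induction (simp_all add: zero_diffop.rep_eq plus_diffop.rep_eq)
  have "diffop_poly (\<Sum>i\<le>diffop_order A. of_ratfun (coeff (diffop_poly A) i) * D_op ^ i)
      = diffop_poly A"
    by (simp add: sum times_diffop.rep_eq diffop_poly_of_ratfun skew_times_def pow smult_monom
        diffop_order_def poly_as_sum_of_monoms)
  then show ?thesis by (simp add: diffop_poly_inject)
qed


section \<open>Action on formal Laurent series\<close>

text \<open>A rational function is expanded at \<open>0\<close>; see \<open>ratfun_to_fls_Fract\<close>.\<close>

definition ratfun_to_fls :: "ratfun \<Rightarrow> complex fls" where
  "ratfun_to_fls x = (case quot_of_fract x of (a, b) \<Rightarrow>
     fps_to_fls (fps_of_poly a) / fps_to_fls (fps_of_poly b))"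

definition diffop_apply :: "diffop \<Rightarrow> complex fls \<Rightarrow> complex fls" where
  "diffop_apply A f =
     (\<Sum>i\<le>diffop_order A. ratfun_to_fls (coeff (diffop_poly A) i) * (fls_deriv ^^ i) f)"

lemma ratfun_to_fls_Fract:
  assumes "b \<noteq> 0"
  shows "ratfun_to_fls (Fraction_Field.Fract a b)
    = fps_to_fls (fps_of_poly a) / fps_to_fls (fps_of_poly b)"
proof -
  let ?f = "\<lambda>p. fps_to_fls (fps_of_poly p) :: complex fls"
  obtain c d where cd: "quot_of_fract (Fraction_Field.Fract a b) = (c, d)" "d \<noteq> 0"
    and e: "a * d = c * b" using assms by (rule quot_of_fract_cases)
  have "?f a * ?f d = ?f c * ?f b"
    using arg_cong[OF e, of ?f] by (simp add: fps_of_poly_mult fls_times_fps_to_fls)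
  then have "?f a / ?f b = ?f c / ?f d"
    using assms cd(2) by (subst frac_eq_eq) simp_all
  then show ?thesis using assms by (simp add: ratfun_to_fls_def cd(1))
qed

lemma ratfun_to_fls_0 [simp]: "ratfun_to_fls 0 = 0"
  using ratfun_to_fls_Fract[of 1 0] by (simp add: Zero_fract_def)

lemma ratfun_to_fls_1 [simp]: "ratfun_to_fls 1 = 1"
  using ratfun_to_fls_Fract[of 1 1] by (simp add: One_fract_def)

lemma ratfun_to_fls_add: "ratfun_to_fls (x + y) = ratfun_to_fls x + ratfun_to_fls y"
proof (cases x; cases y)
  fix a b c d :: "complex poly"
  assume *: "x = Fraction_Field.Fract a b" "b \<noteq> 0" "y = Fraction_Field.Fract c d" "d \<noteq> 0"
  let ?f = "\<lambda>p. fps_to_fls (fps_of_poly p) :: complex fls"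
  have nz: "?f b \<noteq> 0" "?f d \<noteq> 0" using * by simp_all
  have "ratfun_to_fls (x + y) = (?f a * ?f d + ?f c * ?f b) / (?f b * ?f d)"
    using * by (simp add: ratfun_to_fls_Fract fps_of_poly_mult fps_of_poly_add
        fls_times_fps_to_fls)
  also have "\<dots> = ?f a / ?f b + ?f c / ?f d"
    by (rule add_frac_eq[OF nz, symmetric])
  finally show ?thesis using * by (simp add: ratfun_to_fls_Fract)
qed

lemma ratfun_to_fls_mult: "ratfun_to_fls (x * y) = ratfun_to_fls x * ratfun_to_fls y"
  by (cases x; cases y)
     (simp add: ratfun_to_fls_Fract fps_of_poly_mult fls_times_fps_to_fls)

lemma fls_deriv_ratfun: "fls_deriv (ratfun_to_fls x) = ratfun_to_fls (ratfun_deriv x)"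
proof (cases x)
  case (Fract a b)
  let ?f = "\<lambda>p. fps_to_fls (fps_of_poly p) :: complex fls"
  have d: "fls_deriv (?f p) = ?f (pderiv p)" for p
    by (simp add: fls_deriv_fps_to_fls fps_of_poly_pderiv)
  have nz: "?f b \<noteq> 0" using Fract(2) by simp
  have "?f a = ratfun_to_fls x * ?f b"
    using nz by (simp add: Fract(1) ratfun_to_fls_Fract[OF Fract(2)])
  then have "fls_deriv (?f a) = fls_deriv (ratfun_to_fls x * ?f b)" by simp
  then have *: "?f (pderiv a) = fls_deriv (ratfun_to_fls x) * ?f b + ratfun_to_fls x * ?f (pderiv b)"
    by (simp add: d algebra_simps)
  have minus: "?f (p - q) = ?f p - ?f q" for p q
    by (simp add: fps_of_poly_diff)
  have "ratfun_to_fls (ratfun_deriv x)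
      = (?f (pderiv a) * ?f b - ?f a * ?f (pderiv b)) / (?f b * ?f b)"
    using Fract(2) unfolding Fract(1)
    by (simp add: ratfun_deriv_Fract ratfun_to_fls_Fract minus fps_of_poly_mult
        fls_times_fps_to_fls)
  also have "\<dots> = (?f (pderiv a) - ratfun_to_fls x * ?f (pderiv b)) / ?f b"
    using nz by (simp add: Fract(1) ratfun_to_fls_Fract[OF Fract(2)] field_simps)
  also have "\<dots> = fls_deriv (ratfun_to_fls x)"
    using nz unfolding * by simp
  finally show ?thesis by simp
qed

lemma diffop_apply_bound:
  assumes "diffop_order A \<le> n"
  shows "diffop_apply A f
    = (\<Sum>i\<le>n. ratfun_to_fls (coeff (diffop_poly A) i) * (fls_deriv ^^ i) f)"
  unfolding diffop_apply_def using assms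
  by (intro sum.mono_neutral_left) (auto simp: coeff_eq_0 diffop_order_def)

lemma diffop_apply_add: "diffop_apply (A + B) f = diffop_apply A f + diffop_apply B f"
proof -
  let ?n = "max (diffop_order A) (diffop_order B)"
  have "diffop_order (A + B) \<le> ?n"
    by (simp add: diffop_order_def plus_diffop.rep_eq degree_add_le_max)
  then show ?thesis
    by (simp add: diffop_apply_bound[of _ ?n] plus_diffop.rep_eq ratfun_to_fls_add
        distrib_right sum.distrib)
qed

lemma diffop_apply_0 [simp]: "diffop_apply 0 f = 0"
  by (simp add: diffop_apply_def zero_diffop.rep_eq diffop_order_def)

lemma diffop_apply_sum: "diffop_apply (\<Sum>i\<in>I. g i) f = (\<Sum>i\<in>I. diffop_apply (g i) f)"
  by (induction I rule: infinite_finite_induct) (simp_all add: diffop_apply_add)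

lemma diffop_apply_of_ratfun_mult:
  "diffop_apply (of_ratfun a * B) f = ratfun_to_fls a * diffop_apply B f"
proof -
  have *: "diffop_poly (of_ratfun a * B) = smult a (diffop_poly B)"
    by (simp add: diffop_poly_simps skew_times_def)
  have "diffop_order (of_ratfun a * B) \<le> diffop_order B"
    by (simp add: diffop_order_def * degree_smult_le)
  then show ?thesis
    by (simp add: diffop_apply_bound[of _ "diffop_order B"] * ratfun_to_fls_mult
        sum_distrib_left mult.assoc)
qed

lemma fls_deriv_sum': "fls_deriv (\<Sum>i\<in>I. g i) = (\<Sum>i\<in>I. fls_deriv (g i :: complex fls))"
  by (induction I rule: infinite_finite_induct) simp_all

lemma diffop_apply_D_mult: "diffop_apply (D_op * B) f = fls_deriv (diffop_apply B f)"
proof -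
  let ?q = "diffop_poly B" and ?n = "diffop_order B"
  have *: "diffop_poly (D_op * B) = pCons 0 ?q + map_poly ratfun_deriv ?q"
    by (simp add: diffop_poly_simps skew_times_def D_left_def)
  have "diffop_apply (D_op * B) f = diffop_apply (Diffop (pCons 0 ?q)) f
      + diffop_apply (Diffop (map_poly ratfun_deriv ?q)) f"
    by (metis * diffop_poly_Diffop diffop_apply_add diffop_poly_inject plus_diffop.rep_eq)
  also have "diffop_apply (Diffop (pCons 0 ?q)) f
      = (\<Sum>i\<le>Suc ?n. ratfun_to_fls (coeff (pCons 0 ?q) i) * (fls_deriv ^^ i) f)"
    by (subst diffop_apply_bound[of _ "Suc ?n"])
       (simp_all add: diffop_order_def degree_pCons_le)
  also have "\<dots> = (\<Sum>i\<le>?n. ratfun_to_fls (coeff ?q i) * (fls_deriv ^^ Suc i) f)"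
    by (subst sum.atMost_Suc_shift) simp
  also have "diffop_apply (Diffop (map_poly ratfun_deriv ?q)) f
      = (\<Sum>i\<le>?n. ratfun_to_fls (ratfun_deriv (coeff ?q i)) * (fls_deriv ^^ i) f)"
    by (subst diffop_apply_bound[of _ ?n])
       (simp_all add: diffop_order_def degree_map_deriv coeff_map_poly)
  finally show ?thesis
    by (simp add: diffop_apply_def fls_deriv_sum' sum.distrib fls_deriv_ratfun[symmetric]
        algebra_simps)
qed

lemma diffop_apply_mult: "diffop_apply (A * B) f = diffop_apply A (diffop_apply B f)"
proof -
  have pow: "diffop_apply (D_op ^ i * B) f = (fls_deriv ^^ i) (diffop_apply B f)" for i
    by (induction i) (simp_all add: diffop_apply_D_mult mult.assoc)
  have "A * B = (\<Sum>i\<le>diffop_order A. of_ratfun (coeff (diffop_poly A) i) * (D_op ^ i * B))"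
    by (subst diffop_expansion[of A]) (simp add: sum_distrib_right mult.assoc)
  then show ?thesis
    by (simp add: diffop_apply_sum diffop_apply_of_ratfun_mult pow
        diffop_apply_def[of A "diffop_apply B f"])
qed


section \<open>Operators in the Euler derivation\<close>

text \<open>
  The ring \<open>\<complex>[t]\<langle>\<theta>\<rangle>\<close> in the normal form \<open>\<Sum>m. t^m R\<^sub>m(\<theta>)\<close>: the element of type
  \<^typ>\<open>complex poly poly\<close> has outer variable \<open>t\<close> and its \<open>m\<close>-th coefficient is the
  polynomial \<open>R\<^sub>m\<close> in \<open>\<theta>\<close>. The product below (not the one of \<^typ>\<open>complex poly poly\<close>) comes
  from \<open>R(\<theta>) t^k = t^k R(\<theta> + k)\<close>.
\<close>

definition euler_times :: "complex poly poly \<Rightarrow> complex poly poly \<Rightarrow> complex poly poly" where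
  "euler_times P Q = (\<Sum>m\<le>degree P. \<Sum>k\<le>degree Q.
     monom (pcompose (coeff P m) [:of_nat k, 1:] * coeff Q k) (m + k))"

abbreviation euler_theta :: "complex poly poly" where
  "euler_theta \<equiv> [:[:0, 1:]:]"

abbreviation euler_t :: "complex poly poly" where
  "euler_t \<equiv> [:0, 1:]"

definition theta_op :: diffop where
  "theta_op = z_op * D_op"

definition const_op :: "complex \<Rightarrow> diffop" where
  "const_op c = of_ratfun (to_fract [:c:])"

definition poly_theta :: "complex poly \<Rightarrow> diffop" where
  "poly_theta R = (\<Sum>i\<le>degree R. const_op (coeff R i) * theta_op ^ i)"

definition euler_to_diffop :: "complex poly poly \<Rightarrow> diffop" where
  "euler_to_diffop P = (\<Sum>m\<le>degree P. z_op ^ m * poly_theta (coeff P m))"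

lemma const_op_0 [simp]: "const_op 0 = 0"
  by (simp add: const_op_def)

lemma const_op_1 [simp]: "const_op 1 = 1"
  by (simp add: const_op_def flip: one_pCons)

lemma const_op_add: "const_op (a + b) = const_op a + const_op b"
proof -
  have "to_fract [:a + b:] = to_fract [:a:] + to_fract [:b:]"
    by (simp flip: to_fract_add)
  then show ?thesis by (simp only: const_op_def of_ratfun_add)
qed

lemma const_op_mult: "const_op (a * b) = const_op a * const_op b"
proof -
  have "to_fract [:a * b:] = to_fract [:a:] * to_fract [:b:]"
    by (simp add: mult.commute flip: to_fract_mult)
  then show ?thesis by (simp only: const_op_def of_ratfun_mult)
qed

lemma const_op_of_nat: "const_op (of_nat n) = of_nat n"
  by (induction n) (simp_all add: const_op_add)

lemma of_ratfun_commute: "of_ratfun a * of_ratfun b = of_ratfun b * of_ratfun a"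
  by (metis mult.commute of_ratfun_mult)

lemma const_op_commute_theta: "theta_op * const_op c = const_op c * theta_op"
proof -
  have D: "D_op * const_op c = const_op c * D_op"
    by (simp add: const_op_def D_op_of_ratfun pderiv_pCons)
  have z: "z_op * const_op c = const_op c * z_op"
    unfolding const_op_def by (rule of_ratfun_commute)
  show ?thesis unfolding theta_op_def by (metis D z mult.assoc)
qed

lemma const_op_commute_z: "z_op ^ k * const_op c = const_op c * z_op ^ k"
  unfolding const_op_def of_ratfun_power[symmetric] by (rule of_ratfun_commute)

lemma const_op_commute_theta_power: "theta_op ^ k * const_op c = const_op c * theta_op ^ k"
proof (induction k)
  case (Suc k)
  then show ?case by (metis const_op_commute_theta mult.assoc power_Suc)
qed simp

lemma theta_op_z: "theta_op * z_op = z_op * (theta_op + 1)"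
  by (simp add: theta_op_def mult.assoc D_op_z_op)

lemma theta_op_z_power: "theta_op * z_op ^ k = z_op ^ k * (theta_op + of_nat k)"
proof (induction k)
  case (Suc k)
  have "theta_op * z_op ^ Suc k = z_op * (theta_op * z_op ^ k + z_op ^ k)"
    by (simp add: theta_op_z algebra_simps flip: mult.assoc)
  also have "\<dots> = z_op ^ Suc k * (theta_op + of_nat (Suc k))"
    by (simp add: Suc algebra_simps)
  finally show ?case .
qed simp

lemma poly_theta_bound:
  "degree R \<le> n \<Longrightarrow> poly_theta R = (\<Sum>i\<le>n. const_op (coeff R i) * theta_op ^ i)"
  unfolding poly_theta_def by (intro sum.mono_neutral_left) (auto simp: coeff_eq_0)

lemma poly_theta_0 [simp]: "poly_theta 0 = 0"
  by (simp add: poly_theta_def)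

lemma poly_theta_const [simp]: "poly_theta [:c:] = const_op c"
  by (simp add: poly_theta_def)

lemma poly_theta_1 [simp]: "poly_theta 1 = 1"
  using poly_theta_const[of 1] by (simp flip: one_pCons)

lemma poly_theta_add: "poly_theta (R + S) = poly_theta R + poly_theta S"
proof -
  let ?n = "max (degree R) (degree S)"
  have "degree (R + S) \<le> ?n" by (rule degree_add_le_max)
  then show ?thesis
    by (simp add: poly_theta_bound[of _ ?n] const_op_add distrib_right sum.distrib)
qed

lemma poly_theta_pCons: "poly_theta (pCons a R) = const_op a + poly_theta R * theta_op"
proof -
  have "poly_theta (pCons a R)
      = (\<Sum>i\<le>Suc (degree R). const_op (coeff (pCons a R) i) * theta_op ^ i)"
    by (rule poly_theta_bound) (simp add: degree_pCons_le)
  then show ?thesis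
    by (subst (asm) sum.atMost_Suc_shift)
       (simp add: poly_theta_def sum_distrib_right mult.assoc power_commutes)
qed

lemma poly_theta_smult: "poly_theta (smult a R) = const_op a * poly_theta R"
  by (induction R) (simp_all add: poly_theta_pCons const_op_mult distrib_left mult.assoc)

lemma poly_theta_commute: "poly_theta R * theta_op = theta_op * poly_theta R"
proof (induction R)
  case (pCons a R)
  have "theta_op * (poly_theta R * theta_op) = poly_theta R * theta_op * theta_op"
    by (metis pCons.IH mult.assoc)
  then show ?case
    by (simp only: poly_theta_pCons distrib_left distrib_right const_op_commute_theta)
qed simp

lemma poly_theta_mult: "poly_theta (R * S) = poly_theta R * poly_theta S"
proof (induction R)
  case (pCons a R)
  have "poly_theta (pCons a R * S)
      = const_op a * poly_theta S + poly_theta R * (poly_theta S * theta_op)"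
    by (simp add: poly_theta_add poly_theta_smult poly_theta_pCons pCons.IH mult.assoc)
  also have "poly_theta S * theta_op = theta_op * poly_theta S"
    by (rule poly_theta_commute)
  finally show ?case
    by (simp only: poly_theta_pCons distrib_right mult.assoc)
qed simp

lemma poly_theta_z_power:
  "poly_theta R * z_op ^ k = z_op ^ k * poly_theta (pcompose R [:of_nat k, 1:])"
proof (induction R)
  case (pCons a R)
  let ?R = "pcompose R [:of_nat k, 1:]"
  have lin: "poly_theta [:of_nat k, 1:] = theta_op + of_nat k"
    by (simp add: poly_theta_pCons const_op_of_nat add.commute)
  have "poly_theta (pCons a R) * z_op ^ k
      = const_op a * z_op ^ k + poly_theta R * (theta_op * z_op ^ k)"
    by (simp add: poly_theta_pCons distrib_right mult.assoc)
  also have "\<dots> = z_op ^ k * const_op a + z_op ^ k * poly_theta ?R * (theta_op + of_nat k)"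
    by (simp add: theta_op_z_power const_op_commute_z pCons.IH flip: mult.assoc)
  also have "poly_theta ?R * (theta_op + of_nat k) = poly_theta ([:of_nat k, 1:] * ?R)"
    by (metis lin poly_theta_mult mult.commute)
  then have "z_op ^ k * poly_theta ?R * (theta_op + of_nat k)
      = z_op ^ k * poly_theta ([:of_nat k, 1:] * ?R)"
    by (simp only: mult.assoc)
  finally show ?case
    by (simp only: pcompose_pCons poly_theta_add poly_theta_const distrib_left)
qed simp

lemma euler_to_diffop_bound:
  "degree P \<le> n \<Longrightarrow> euler_to_diffop P = (\<Sum>m\<le>n. z_op ^ m * poly_theta (coeff P m))"
  unfolding euler_to_diffop_def by (intro sum.mono_neutral_left) (auto simp: coeff_eq_0)

lemma euler_to_diffop_0 [simp]: "euler_to_diffop 0 = 0"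
  by (simp add: euler_to_diffop_def)

lemma euler_to_diffop_1: "euler_to_diffop 1 = 1"
  by (simp add: euler_to_diffop_def)

lemma euler_to_diffop_theta: "euler_to_diffop euler_theta = theta_op"
  by (simp add: euler_to_diffop_def poly_theta_pCons)

lemma euler_to_diffop_t: "euler_to_diffop euler_t = z_op"
  by (simp add: euler_to_diffop_def)

lemma euler_to_diffop_add: "euler_to_diffop (P + Q) = euler_to_diffop P + euler_to_diffop Q"
proof -
  let ?n = "max (degree P) (degree Q)"
  have "degree (P + Q) \<le> ?n" by (rule degree_add_le_max)
  then show ?thesis
    by (simp add: euler_to_diffop_bound[of _ ?n] poly_theta_add distrib_left sum.distrib)
qed

lemma euler_to_diffop_sum: "euler_to_diffop (\<Sum>i\<in>I. f i) = (\<Sum>i\<in>I. euler_to_diffop (f i))"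
  by (induction I rule: infinite_finite_induct) (simp_all add: euler_to_diffop_add)

lemma euler_to_diffop_monom: "euler_to_diffop (monom R m) = z_op ^ m * poly_theta R"
proof -
  have "euler_to_diffop (monom R m) = (\<Sum>i\<le>m. z_op ^ i * poly_theta (coeff (monom R m) i))"
    by (rule euler_to_diffop_bound) (rule degree_monom_le)
  also have "\<dots> = (\<Sum>i\<le>m. if i = m then z_op ^ i * poly_theta R else 0)"
    by (intro sum.cong) auto
  finally show ?thesis by simp
qed

text \<open>\<open>euler_times\<close> is the multiplication of operators, with \<open>t = z\<close> and \<open>\<theta> = z D\<close>.\<close>

lemma euler_to_diffop_times:
  "euler_to_diffop (euler_times P Q) = euler_to_diffop P * euler_to_diffop Q"
proof -
  have "z_op ^ (m + k) * poly_theta (pcompose R [:of_nat k, 1:] * S)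
      = (z_op ^ m * poly_theta R) * (z_op ^ k * poly_theta S)" for m k R S
  proof -
    have "(z_op ^ m * poly_theta R) * (z_op ^ k * poly_theta S)
        = z_op ^ m * (poly_theta R * z_op ^ k) * poly_theta S"
      by (simp only: mult.assoc)
    then show ?thesis
      by (simp only: poly_theta_z_power poly_theta_mult power_add mult.assoc)
  qed
  then show ?thesis
    by (simp add: euler_times_def euler_to_diffop_sum euler_to_diffop_monom
        euler_to_diffop_def[of P] euler_to_diffop_def[of Q] sum_product)
qed


section \<open>The operator and the generating function\<close>

text \<open>
  The factor \<open>d - n + 1\<close> of the recurrence is formed in \<open>\<complex>\<close>, so it does not truncate; only the
  indices \<open>n \<le> d + 1\<close> are used.
\<close>

fun P_op :: "nat \<Rightarrow> nat \<Rightarrow> complex poly poly" where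
  "P_op d 0 = 1"
| "P_op d (Suc 0) = euler_theta"
| "P_op d (Suc (Suc n)) = euler_times euler_theta (P_op d (Suc n))
     - euler_times (smult [:of_nat (Suc n) * (of_nat d - of_nat (Suc n) + 1):] euler_t) (P_op d n)"

definition R_B :: "nat \<Rightarrow> nat \<Rightarrow> complex poly" where
  "R_B d m = coeff (P_op d (d + 1)) m"

definition R_poly :: "nat \<Rightarrow> nat \<Rightarrow> complex poly" where
  "R_poly d k = (if k = 0 then monom 1 (d - 1)
     else R_B d k * (\<Prod>j = 1..k - 1. [:of_nat j, 1:] ^ 2))"

text \<open>The operator defined by the equation \<open>z_op_L_F\<close> below.\<close>

definition L_F :: "nat \<Rightarrow> diffop" where
  "L_F d = of_ratfun (inverse ratfun_var)
     * (\<Sum>k\<le>(d + 1) div 2. z_op ^ k * poly_theta (R_poly d k))"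

lemma z_op_L_F: "z_op * L_F d = (\<Sum>k\<le>(d + 1) div 2. z_op ^ k * poly_theta (R_poly d k))"
proof -
  have "z_op * of_ratfun (inverse ratfun_var) = 1"
    by (simp flip: of_ratfun_mult)
  then show ?thesis by (simp add: L_F_def flip: mult.assoc)
qed

lemma degree_euler_times: "degree (euler_times P Q) \<le> degree P + degree Q"
  unfolding euler_times_def
  by (intro degree_sum_le order.trans[OF degree_monom_le]) (auto intro: add_mono)

text \<open>No term of \<open>P_op d (d + 1)\<close> is lost by stopping at \<open>(d + 1) div 2\<close>.\<close>

lemma degree_P_op: "degree (P_op d n) \<le> n div 2"
proof (induction d n rule: P_op.induct)
  case (3 d n)
  let ?c = "[:of_nat (Suc n) * (of_nat d - of_nat (Suc n) + 1):] :: complex poly"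
  have "degree (euler_times euler_theta (P_op d (Suc n))) \<le> Suc (Suc n) div 2"
    using degree_euler_times[of euler_theta "P_op d (Suc n)"] 3 by simp
  moreover have "degree (smult ?c euler_t) \<le> 1"
    by (rule order.trans[OF degree_smult_le]) simp
  then have "degree (euler_times (smult ?c euler_t) (P_op d n)) \<le> Suc (Suc n) div 2"
    using degree_euler_times[of "smult ?c euler_t" "P_op d n"] 3 by linarith
  ultimately show ?case unfolding P_op.simps by (rule degree_diff_le)
qed simp_all

definition x_seq :: "nat \<Rightarrow> nat \<Rightarrow> complex" where
  "x_seq d n = (\<Sum>ns | length ns = d \<and> sum_list ns = n.
     (fact n)\<^sup>2 / (\<Prod>i<d. fact (ns ! i))\<^sup>2)"

lemma finite_compositions: "finite {ns :: nat list. length ns = d \<and> sum_list ns = n}"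
  by (rule finite_subset[OF _ finite_lists_length_eq[of "{..n}" d]])
     (auto dest: member_le_sum_list)

definition F_series :: "nat \<Rightarrow> complex fps" where
  "F_series d = Abs_fps (x_seq d)"

end

theory Submission
  imports Defs "HOL-Computational_Algebra.Fundamental_Theorem_Algebra"
begin

text \<open>
  Let \<open>n = d - 1\<close> and \<open>r = (d + 1) div 2\<close>, and let \<open>q\<close> be the polynomial whose \<open>k\<close>-th coefficient is
  that of \<open>\<theta>^n\<close> in \<open>R_poly d k\<close>, so that \<open>z L_F\<close> has the leading coefficient \<open>z^n q\<close>.

  \<^emph>\<open>Annihilation.\<close> The series \<open>y = \<Sum>n. z^n / (n!)\<^sup>2\<close> satisfies \<open>\<theta>\<^sup>2 y = z y\<close>, and the coefficients of
  \<open>y^d\<close> are \<open>x_seq d n / (n!)\<^sup>2\<close>. The recurrence of \<open>P_op\<close> is made such that \<open>P_op d m\<close> sends \<open>y^d\<close> to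
  \<open>d (d - 1) ... (d - m + 1) y^(d - m) (\<theta> y)^m\<close>, which is \<open>0\<close> for \<open>m = d + 1\<close> (\<open>diffop_apply_P_op\<close>).
  The passage from \<open>R_B\<close> to \<open>R_poly\<close> removes the factor \<open>1 / (n!)\<^sup>2\<close> from the coefficients.

  \<^emph>\<open>Irreducibility.\<close> The argument is the Fuchs relation. At every point, infinity included, the part of
  extremal weight of an operator is a polynomial in the Euler derivation, whose roots are the local
  exponents. This indicial polynomial is multiplicative (\<open>extremal_comp\<close>) and its degree is at most the
  order. For \<open>L_F\<close> the degree is the order everywhere; hence the same holds for each right factor \<open>B\<close>, and
  the exponents of \<open>B\<close> are some of those of \<open>L_F\<close> (\<open>right_factor_indicial\<close>). If \<open>B\<close> has order \<open>k\<close> and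
  \<open>u / v\<close> is the quotient of its coefficients of \<open>D^(k - 1)\<close> and \<open>D^k\<close>, then the sum of the exponents of \<open>B\<close>
  at a finite point is \<open>k (k - 1) / 2\<close> minus the residue of \<open>u / v\<close>. The residues add up to the
  corresponding number at infinity (\<open>sum_residues\<close>).

  The exponents of \<open>L_F\<close> are \<open>0\<close>, \<open>n\<close> times, at \<open>0\<close>; \<open>0, ..., n - 2, (n - 2) / 2\<close> at each root of \<open>q\<close>;
  \<open>0, ..., n - 1\<close> at all other finite points; and \<open>1, 1, ..., r - 1, r - 1\<close>, together with \<open>r / 2\<close> for even
  \<open>d\<close>, at infinity. So the sum of the exponents of \<open>B\<close> at infinity is at most \<open>r max (0, k - n / 2)\<close>
  (\<open>fuchs_inequality\<close>), and no \<open>k\<close> of the exponents of \<open>L_F\<close> at infinity have such a small sum if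
  \<open>1 \<le> k < n\<close> (\<open>exponent_sum_contradiction\<close>).

  The exponents at the roots of \<open>q\<close> rest on two facts. The roots are simple: they are the \<open>r\<close> numbers
  \<open>1 / (d - 2 j)\<^sup>2\<close> (\<open>top_symbol_root\<close>). And the second coefficient of \<open>z L_F\<close> is determined by the first,
  because \<open>P_op d (d + 1)\<close> is a continuant with palindromic weights and so is self-adjoint up to sign
  (\<open>R_B_reflect\<close>).
\<close>


section \<open>Operators with polynomial coefficients and their indicial polynomials\<close>

text \<open>
  The \<open>i\<close>-th coefficient of \<open>\<beta>\<close> is the factor of \<open>D^i\<close>; keeping all data polynomial
  makes leading and lowest terms at a point directly readable.
\<close>

definition act :: "complex poly poly \<Rightarrow> complex poly \<Rightarrow> complex poly" where
  "act \<beta> f = (\<Sum>i\<le>degree \<beta>. coeff \<beta> i * (pderiv ^^ i) f)"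

definition falling_poly :: "nat \<Rightarrow> complex poly" where
  "falling_poly i = (\<Prod>j<i. [:- of_nat j, 1:])"

definition int_coeff :: "complex poly \<Rightarrow> int \<Rightarrow> complex" where
  "int_coeff p z = (if z < 0 then 0 else coeff p (nat z))"

text \<open>
  Since \<open>z^j D^i = z^(j - i) (\<theta>)\<^sub>i\<close> with the falling factorial \<open>(\<theta>)\<^sub>i\<close>, every operator is a sum
  over the weights \<open>w = j - i\<close>, possibly negative, of terms \<open>z^w\<close> times a polynomial in
  \<open>\<theta>\<close>; the polynomial at weight \<open>w\<close> is defined here.
\<close>

definition indicial :: "complex poly poly \<Rightarrow> int \<Rightarrow> complex poly" where
  "indicial \<beta> w = (\<Sum>i\<le>degree \<beta>. smult (int_coeff (coeff \<beta> i) (int i + w)) (falling_poly i))"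

lemma falling_poly_Suc: "falling_poly (Suc i) = falling_poly i * [:- of_nat i, 1:]"
  by (simp add: falling_poly_def mult.commute)

lemma degree_falling_poly: "degree (falling_poly i) = i"
  by (simp add: falling_poly_def degree_prod_eq_sum_degree)

lemma coeff_falling_poly_top: "coeff (falling_poly i) i = 1"
proof -
  have "lead_coeff (falling_poly i) = 1" by (simp add: falling_poly_def lead_coeff_prod)
  then show ?thesis by (simp add: degree_falling_poly)
qed

lemma coeff_falling_poly_next: "coeff (falling_poly (Suc i)) i = - (of_nat i * of_nat (Suc i) / 2)"
proof (induction i)
  case 0
  then show ?case by (simp add: falling_poly_def)
next
  case (Suc i)
  have "coeff (falling_poly (Suc (Suc i))) (Suc i) =
     coeff (falling_poly (Suc i)) i - of_nat (Suc i) * coeff (falling_poly (Suc i)) (Suc i)"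
    by (subst falling_poly_Suc) (simp add: algebra_simps)
  then show ?case using Suc by (simp add: coeff_falling_poly_top field_simps)
qed

lemma poly_falling_poly_zero: "s < i \<Longrightarrow> poly (falling_poly i) (of_nat s) = 0"
  by (auto simp: falling_poly_def poly_prod)

lemma pderiv_pow_monom:
  "(pderiv ^^ i) (monom 1 s) = monom (poly (falling_poly i) (of_nat s)) (s - i)"
proof (induction i)
  case 0
  then show ?case by (simp add: falling_poly_def)
next
  case (Suc i)
  show ?case
  proof (cases "i \<le> s")
    case True
    then show ?thesis
      by (simp add: Suc pderiv_monom falling_poly_Suc of_nat_diff algebra_simps)
  next
    case False
    then show ?thesis by (simp add: Suc poly_falling_poly_zero pderiv_monom)
  qed
qed

text \<open>
  On \<open>z^s\<close> the part of weight \<open>w\<close> has eigenvalue \<open>indicial \<beta> w (s)\<close>. As polynomials are determined by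
  their values at large integers, the action on monomials recovers all the weight parts.
\<close>

lemma coeff_act_monom:
  "coeff (act \<beta> (monom 1 s)) m = poly (indicial \<beta> (int m - int s)) (of_nat s)"
proof -
  have "coeff (coeff \<beta> i * (pderiv ^^ i) (monom 1 s)) m =
      poly (smult (int_coeff (coeff \<beta> i) (int i + (int m - int s))) (falling_poly i)) (of_nat s)" for i
  proof (cases "i \<le> s")
    case True
    then have "nat (int i + (int m - int s)) = m - (s - i)"
      by linarith
    with True show ?thesis
      by (auto simp: pderiv_pow_monom int_coeff_def mult.commute[of _ "monom _ _"] coeff_monom_mult)
  next
    case False
    then show ?thesis by (simp add: pderiv_pow_monom poly_falling_poly_zero)
  qed
  then show ?thesis by (simp add: act_def indicial_def coeff_sum poly_sum)
qed

lemma pderiv_pow_add: "(pderiv ^^ i) (f + g) = (pderiv ^^ i) f + (pderiv ^^ i) (g::complex poly)"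
  by (induction i) (simp_all add: pderiv_add)

lemma pderiv_pow_smult: "(pderiv ^^ i) (smult c f) = smult c ((pderiv ^^ i) (f::complex poly))"
  by (induction i) (simp_all add: pderiv_smult)

lemma act_add: "act \<beta> (f + g) = act \<beta> f + act \<beta> g"
  by (simp add: act_def pderiv_pow_add distrib_left sum.distrib)

lemma act_smult: "act \<beta> (smult c f) = smult c (act \<beta> f)"
  by (simp add: act_def pderiv_pow_smult smult_sum_right)

lemma act_0: "act \<beta> 0 = 0"
  using act_smult[of \<beta> 0 0] by simp

lemma act_sum: "act \<beta> (\<Sum>i\<in>I. f i) = (\<Sum>i\<in>I. act \<beta> (f i))"
  by (induction I rule: infinite_finite_induct) (simp_all add: act_add act_0)

lemma coeff_act_act_monom:
  assumes "degree (act \<beta> (monom 1 s)) \<le> M"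
  shows "coeff (act \<alpha> (act \<beta> (monom 1 s))) n =
    (\<Sum>m\<le>M. poly (indicial \<beta> (int m - int s)) (of_nat s)
       * poly (indicial \<alpha> (int n - int m)) (of_nat m))"
proof -
  have "act \<beta> (monom 1 s) = (\<Sum>m\<le>M. smult (coeff (act \<beta> (monom 1 s)) m) (monom 1 m))"
    using assms by (simp add: smult_monom poly_as_sum_of_monoms')
  then have "act \<alpha> (act \<beta> (monom 1 s)) =
     (\<Sum>m\<le>M. smult (coeff (act \<beta> (monom 1 s)) m) (act \<alpha> (monom 1 m)))"
    by (metis (no_types, lifting) act_smult act_sum sum.cong)
  then show ?thesis by (simp add: coeff_sum coeff_act_monom)
qed

lemma poly_eqI_nat:
  fixes p q :: "complex poly"
  assumes "\<And>s. s \<ge> N \<Longrightarrow> poly p (of_nat s) = poly q (of_nat s)"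
  shows "p = q"
proof (rule ccontr)
  assume "p \<noteq> q"
  then have fin: "finite {x. poly (p - q) x = 0}" by (intro poly_roots_finite) simp
  have "(of_nat :: nat \<Rightarrow> complex) ` {N..} \<subseteq> {x. poly (p - q) x = 0}"
    using assms by auto
  then have "finite ((of_nat :: nat \<Rightarrow> complex) ` {N..})" using fin finite_subset by blast
  then have "finite {N..}" by (rule finite_imageD) (simp add: inj_on_def)
  then show False by (simp add: infinite_Ici)
qed

text \<open>
  For \<open>\<sigma> = 1\<close> the lowest weight, whose polynomial has the exponents at \<open>0\<close> as roots; for
  \<open>\<sigma> = - 1\<close> the highest one, whose roots are the negated exponents at infinity.
\<close>

definition extremal :: "int \<Rightarrow> complex poly poly \<Rightarrow> int \<Rightarrow> bool" where
  "extremal \<sigma> \<beta> w \<longleftrightarrow> indicial \<beta> w \<noteq> 0 \<and> (\<forall>w'. indicial \<beta> w' \<noteq> 0 \<longrightarrow> \<sigma> * w \<le> \<sigma> * w')"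

text \<open>
  The coefficient of a composition on \<open>z^s\<close> at the extremal total weight can only come from the
  extremal part of each factor; the right factor first moves \<open>s\<close> to \<open>s + b\<close>, hence the shift.
\<close>

lemma extremal_comp:
  assumes \<sigma>: "\<sigma> = 1 \<or> \<sigma> = -1"
    and comp: "\<And>f. act \<gamma> f = act \<alpha> (act \<beta> f)"
    and a: "extremal \<sigma> \<alpha> a" and b: "extremal \<sigma> \<beta> b"
  shows "indicial \<gamma> (a + b) = pcompose (indicial \<alpha> a) [:of_int b, 1:] * indicial \<beta> b"
    and "extremal \<sigma> \<gamma> (a + b)"
proof -
  have sum: "poly (indicial \<gamma> w) (of_nat s) =
    (\<Sum>m\<le>degree (act \<beta> (monom 1 s)). poly (indicial \<beta> (int m - int s)) (of_nat s)
       * poly (indicial \<alpha> (int (nat (int s + w)) - int m)) (of_nat m))"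
    if "s \<ge> nat \<bar>w\<bar>" for s w
  proof -
    have "w = int (nat (int s + w)) - int s" using that by linarith
    then show ?thesis
      using coeff_act_monom[of \<gamma> s "nat (int s + w)"]
        coeff_act_act_monom[OF order.refl, of \<alpha> \<beta> s "nat (int s + w)"] comp by simp
  qed
  have zero: "poly (indicial \<beta> (int m - int s)) (of_nat s)
       * poly (indicial \<alpha> (int (nat (int s + w)) - int m)) (of_nat m) = 0"
    if "s \<ge> nat \<bar>w\<bar>" "\<sigma> * w < \<sigma> * (a + b) \<or> (w = a + b \<and> int m \<noteq> int s + b)" for s w m
  proof (rule ccontr)
    assume "\<not> ?thesis"
    moreover have "int (nat (int s + w)) = int s + w" using that(1) by linarith
    ultimately have "indicial \<beta> (int m - int s) \<noteq> 0" "indicial \<alpha> (int s + w - int m) \<noteq> 0"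
      by auto
    then have "\<sigma> * b \<le> \<sigma> * (int m - int s)" "\<sigma> * a \<le> \<sigma> * (int s + w - int m)"
      using a b unfolding extremal_def by auto
    then show False using \<sigma> that(2) by auto
  qed
  have z: "indicial \<gamma> w = 0" if "\<sigma> * w < \<sigma> * (a + b)" for w
  proof (rule poly_eqI_nat[where N = "nat \<bar>w\<bar>"])
    fix s assume s: "s \<ge> nat \<bar>w\<bar>"
    show "poly (indicial \<gamma> w) (of_nat s) = poly 0 (of_nat s)"
      unfolding sum[OF s] poly_0 using that by (intro sum.neutral ballI zero[OF s]) simp
  qed
  show eq: "indicial \<gamma> (a + b) = pcompose (indicial \<alpha> a) [:of_int b, 1:] * indicial \<beta> b"
  proof (rule poly_eqI_nat[where N = "nat \<bar>a + b\<bar> + nat \<bar>b\<bar>"])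
    fix s assume "s \<ge> nat \<bar>a + b\<bar> + nat \<bar>b\<bar>"
    then have s: "s \<ge> nat \<bar>a + b\<bar>" "s \<ge> nat \<bar>b\<bar>" by auto
    define g where "g m = poly (indicial \<beta> (int m - int s)) (of_nat s)
       * poly (indicial \<alpha> (int (nat (int s + (a + b))) - int m)) (of_nat m)" for m
    define m0 where "m0 = nat (int s + b)"
    have m0: "int m0 = int s + b" using s(2) by (simp add: m0_def)
    have g0: "g m = 0" if "m \<noteq> m0" for m
      unfolding g_def using zero[OF s(1), of m] that m0 by auto
    have g1: "g m0 = 0" if "m0 > degree (act \<beta> (monom 1 s))"
      using coeff_eq_0[OF that] by (simp add: g_def coeff_act_monom)
    have "poly (indicial \<gamma> (a + b)) (of_nat s) = (\<Sum>m\<le>degree (act \<beta> (monom 1 s)). g m)"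
      unfolding sum[OF s(1)] g_def ..
    also have "\<dots> = g m0"
    proof (cases "m0 \<le> degree (act \<beta> (monom 1 s))")
      case True
      then show ?thesis by (subst sum.remove[of _ m0]) (auto intro!: sum.neutral g0)
    next
      case False
      then show ?thesis using g1 by (auto intro!: sum.neutral g0)
    qed
    also have "\<dots> = poly (indicial \<beta> b) (of_nat s) * poly (indicial \<alpha> a) (of_nat s + of_int b)"
    proof -
      have "of_nat m0 = of_nat s + (of_int b :: complex)"
        using arg_cong[OF m0, of "of_int :: int \<Rightarrow> complex"] by simp
      moreover have "int m0 - int s = b" "int (nat (int s + (a + b))) - int m0 = a"
        using m0 s(1) by linarith+
      ultimately show ?thesis unfolding g_def by simp
    qed
    finally show "poly (indicial \<gamma> (a + b)) (of_nat s) =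
        poly (pcompose (indicial \<alpha> a) [:of_int b, 1:] * indicial \<beta> b) (of_nat s)"
      by (simp add: poly_pcompose algebra_simps)
  qed
  have "pcompose (indicial \<alpha> a) [:of_int b, 1:] \<noteq> 0"
    using a by (simp add: extremal_def pcompose_eq_0_iff)
  then have "indicial \<gamma> (a + b) \<noteq> 0"
    using b eq by (simp add: extremal_def)
  then show "extremal \<sigma> \<gamma> (a + b)" unfolding extremal_def using z not_le by blast
qed

lemma extremal_unique:
  "\<sigma> = 1 \<or> \<sigma> = -1 \<Longrightarrow> extremal \<sigma> \<beta> w \<Longrightarrow> extremal \<sigma> \<beta> w' \<Longrightarrow> w = w'"
  unfolding extremal_def by (metis mult_1 mult_minus_left neg_le_iff_le order_antisym)

lemma degree_indicial: "degree (indicial \<beta> w) \<le> degree \<beta>"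
  unfolding indicial_def
  by (intro degree_sum_le order.trans[OF degree_smult_le]) (auto simp: degree_falling_poly)

lemma coeff_indicial_top:
  "coeff (indicial \<beta> w) (degree \<beta>) = int_coeff (coeff \<beta> (degree \<beta>)) (int (degree \<beta>) + w)"
proof -
  have "coeff (falling_poly i) (degree \<beta>) = (if i = degree \<beta> then 1 else 0)" if "i \<le> degree \<beta>" for i
    using that by (auto simp: coeff_falling_poly_top coeff_eq_0 degree_falling_poly)
  then have "coeff (indicial \<beta> w) (degree \<beta>) = (\<Sum>i\<le>degree \<beta>.
      if i = degree \<beta> then int_coeff (coeff \<beta> (degree \<beta>)) (int (degree \<beta>) + w) else 0)"
    unfolding indicial_def coeff_sum by (intro sum.cong) auto
  then show ?thesis by simp
qed

lemma coeff_indicial_next: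
  assumes "degree \<beta> = Suc k"
  shows "coeff (indicial \<beta> w) k = int_coeff (coeff \<beta> k) (int k + w)
    - of_nat k * of_nat (Suc k) / 2 * int_coeff (coeff \<beta> (Suc k)) (int (Suc k) + w)"
proof -
  let ?c = "\<lambda>i. int_coeff (coeff \<beta> i) (int i + w)"
  have "coeff (indicial \<beta> w) k = (\<Sum>i\<le>Suc k. ?c i * coeff (falling_poly i) k)"
    by (simp add: indicial_def coeff_sum assms)
  also have "\<dots> = (\<Sum>i\<le>k. ?c i * coeff (falling_poly i) k) + ?c (Suc k) * coeff (falling_poly (Suc k)) k"
    by simp
  also have "(\<Sum>i\<le>k. ?c i * coeff (falling_poly i) k) = (\<Sum>i\<le>k. if i = k then ?c k else 0)"
    by (intro sum.cong) (auto simp: coeff_falling_poly_top coeff_eq_0 degree_falling_poly)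
  finally show ?thesis by (simp add: coeff_falling_poly_next)
qed

lemma extremal_exists:
  assumes "\<beta> \<noteq> 0"
  obtains w where "extremal \<sigma> \<beta> w"
proof -
  let ?S = "{w. indicial \<beta> w \<noteq> 0}"
  have "?S \<subseteq> (\<Union>i\<le>degree \<beta>. {- int i .. int (degree (coeff \<beta> i)) - int i})"
  proof
    fix w assume "w \<in> ?S"
    then have "\<exists>i\<le>degree \<beta>. int_coeff (coeff \<beta> i) (int i + w) \<noteq> 0"
      unfolding indicial_def by (auto intro: ccontr)
    then obtain i where i: "i \<le> degree \<beta>" "int_coeff (coeff \<beta> i) (int i + w) \<noteq> 0" by auto
    then have "int i + w \<ge> 0" "nat (int i + w) \<le> degree (coeff \<beta> i)"
      by (auto simp: int_coeff_def le_degree split: if_splits)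
    then show "w \<in> (\<Union>i\<le>degree \<beta>. {- int i .. int (degree (coeff \<beta> i)) - int i})"
      using i(1) by force
  qed
  then have fin: "finite ?S" by (rule finite_subset) simp
  let ?b = "coeff \<beta> (degree \<beta>)"
  have "coeff (indicial \<beta> (int (degree ?b) - int (degree \<beta>))) (degree \<beta>) \<noteq> 0"
    using assms by (simp add: coeff_indicial_top int_coeff_def)
  then have "?S \<noteq> {}" by (metis (mono_tags, lifting) coeff_0 empty_iff mem_Collect_eq)
  with fin have "extremal \<sigma> \<beta> (arg_min_on (\<lambda>w. \<sigma> * w) ?S)"
    unfolding extremal_def
    using arg_min_if_finite(1)[OF fin, of "\<lambda>w. \<sigma> * w"] arg_min_least[OF fin, of _ "\<lambda>w. \<sigma> * w"]
    by auto
  then show ?thesis by (rule that)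
qed

lemma act_const: "act [:h:] f = h * f"
  by (simp add: act_def)

lemma indicial_const: "indicial [:h:] w = [:int_coeff h w:]"
  by (simp add: indicial_def falling_poly_def)

text \<open>
  The degree of an indicial polynomial is at most the order, with equality exactly in the regular
  singular case. Degrees and orders are both additive, so a regular singular product forces its
  factors to be regular singular. The factor \<open>h\<close> is a common denominator; as an operator of
  order \<open>0\<close> it has a constant indicial polynomial.
\<close>

lemma right_factor_indicial:
  assumes \<sigma>: "\<sigma> = 1 \<or> \<sigma> = -1"
    and h: "h \<noteq> 0" and \<alpha>: "\<alpha> \<noteq> 0" and \<beta>: "\<beta> \<noteq> 0"
    and comp: "\<And>f. h * act L f = act \<alpha> (act \<beta> f)"
    and deg: "degree L = degree \<alpha> + degree \<beta>"
    and ext: "extremal \<sigma> L w" and reg: "degree (indicial L w) = degree L"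
  obtains v where "extremal \<sigma> \<beta> v" "degree (indicial \<beta> v) = degree \<beta>"
    "indicial \<beta> v dvd indicial L w"
proof -
  obtain a where a: "extremal \<sigma> \<alpha> a" using \<alpha> by (rule extremal_exists)
  obtain b where b: "extremal \<sigma> \<beta> b" using \<beta> by (rule extremal_exists)
  have "[:h:] \<noteq> 0" using h by simp
  then obtain e where e: "extremal \<sigma> [:h:] e" by (rule extremal_exists)
  have e0: "int_coeff h e \<noteq> 0" using e by (simp add: extremal_def indicial_const)
  define \<gamma> where "\<gamma> = smult h L"
  have act\<gamma>: "act \<gamma> f = h * act L f" for f
    using h by (simp add: \<gamma>_def act_def sum_distrib_left mult.assoc degree_smult_eq)
  have 1: "indicial \<gamma> (a + b) = pcompose (indicial \<alpha> a) [:of_int b, 1:] * indicial \<beta> b"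
      "extremal \<sigma> \<gamma> (a + b)"
    using extremal_comp[OF \<sigma> _ a b, of \<gamma>] comp act\<gamma> by auto
  have 2: "indicial \<gamma> (e + w) = pcompose (indicial [:h:] e) [:of_int w, 1:] * indicial L w"
      "extremal \<sigma> \<gamma> (e + w)"
    using extremal_comp[OF \<sigma> _ e ext, of \<gamma>] act\<gamma> act_const by auto
  have "a + b = e + w" using extremal_unique[OF \<sigma> 1(2) 2(2)] .
  then have eq: "smult (int_coeff h e) (indicial L w) =
      pcompose (indicial \<alpha> a) [:of_int b, 1:] * indicial \<beta> b"
    using 1(1) 2(1) by (simp add: indicial_const)
  have nz: "indicial \<alpha> a \<noteq> 0" "indicial \<beta> b \<noteq> 0" using a b by (auto simp: extremal_def)
  have "degree (indicial L w) = degree (smult (int_coeff h e) (indicial L w))"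
    using e0 by simp
  also have "\<dots> = degree (indicial \<alpha> a) + degree (indicial \<beta> b)"
    unfolding eq using nz by (subst degree_mult_eq) (auto simp: pcompose_eq_0_iff degree_pcompose)
  finally have "degree (indicial \<alpha> a) + degree (indicial \<beta> b) = degree \<alpha> + degree \<beta>"
    using reg deg by simp
  then have 3: "degree (indicial \<beta> b) = degree \<beta>"
    using degree_indicial[of \<alpha> a] degree_indicial[of \<beta> b] by linarith
  have "indicial \<beta> b dvd smult (int_coeff h e) (indicial L w)" unfolding eq by simp
  then have "indicial \<beta> b dvd indicial L w" using e0 by (simp add: dvd_smult_iff)
  then show ?thesis using that b 3 by blast
qed


section \<open>Residues, roots and partial fractions\<close>

abbreviation shift_poly :: "complex \<Rightarrow> complex poly \<Rightarrow> complex poly" where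
  "shift_poly p f \<equiv> pcompose f [:p, 1:]"

lemma shift_poly_inverse: "shift_poly (- p) (shift_poly p f) = f" 
  using pcompose_assoc[of f "[:p, 1:]" "[:- p, 1:]"] by (simp add: pcompose_pCons)

lemma linear_power_dvd_iff_coeff_shift:
  "[:- p, 1:] ^ e dvd f \<longleftrightarrow> (\<forall>j<e. coeff (shift_poly p f) j = 0)"
proof -
  have mono: "shift_poly q a dvd shift_poly q b" if "a dvd b" for q a b
    using that by (auto simp: pcompose_mult elim!: dvdE)
  have pow: "shift_poly q (a ^ n) = shift_poly q a ^ n" for q a n
    by (induction n) (simp_all add: pcompose_mult pcompose_1)
  have 1: "shift_poly p ([:- p, 1:] ^ e) = monom 1 e"
    by (simp add: pow pcompose_pCons monom_altdef)
  have "shift_poly (- p) (monom 1 e) = [:- p, 1:] ^ e"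
    using shift_poly_inverse[of "[:- p, 1:] ^ e" p] by (simp add: 1)
  then have "[:- p, 1:] ^ e dvd f \<longleftrightarrow> monom 1 e dvd shift_poly p f"
    using mono[of "[:- p, 1:] ^ e" f p] mono[of "monom 1 e" "shift_poly p f" "- p"] 1
    by (auto simp: shift_poly_inverse)
  then show ?thesis by (simp add: monom_1_dvd_iff')
qed

lemma coeff_shift_order:
  assumes "v \<noteq> 0"
  shows "j < order p v \<Longrightarrow> coeff (shift_poly p v) j = 0"
    and "coeff (shift_poly p v) (order p v) \<noteq> 0"
proof -
  have *: "\<forall>j<order p v. coeff (shift_poly p v) j = 0"
    using order_1[of p v] linear_power_dvd_iff_coeff_shift by blast
  then show "j < order p v \<Longrightarrow> coeff (shift_poly p v) j = 0" by blast
  show "coeff (shift_poly p v) (order p v) \<noteq> 0"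
    using * order_2[OF assms, of p] linear_power_dvd_iff_coeff_shift[of p "Suc (order p v)" v]
    by (auto simp: less_Suc_eq)
qed

text \<open>
  The sum of the residues of \<open>u / v\<close> equals its leading coefficient at infinity, provided that all
  poles are simple although \<open>v\<close> may have multiple roots. The interpolant
  \<open>\<Sum>p. \<rho> p v / (z - p)\<close> agrees with \<open>u\<close> at each root of \<open>v\<close> to the full order there, and both have
  degree below that of \<open>v\<close>, so they coincide.
\<close>

lemma sum_residues:
  fixes u v :: "complex poly"
  assumes v: "v \<noteq> 0" and deg: "degree u < degree v"
    and simple: "\<And>p j. poly v p = 0 \<Longrightarrow> Suc j < order p v \<Longrightarrow> coeff (shift_poly p u) j = 0"
  shows "(\<Sum>p | poly v p = 0. coeff (shift_poly p u) (order p v - 1)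
      / coeff (shift_poly p v) (order p v)) = coeff u (degree v - 1) / lead_coeff v"
proof -
  let ?S = "{p. poly v p = 0}"
  define \<rho> where "\<rho> p = coeff (shift_poly p u) (order p v - 1)
      / coeff (shift_poly p v) (order p v)" for p
  define V where "V p = v div [:- p, 1:]" for p
  have fin: "finite ?S" using v by (rule poly_roots_finite)
  have V: "v = [:- p, 1:] * V p" if "p \<in> ?S" for p
    using that by (metis V_def dvd_mult_div_cancel mem_Collect_eq poly_eq_0_iff_dvd)
  have V0: "V p \<noteq> 0" if "p \<in> ?S" for p
    using V[OF that] v by auto
  have degV: "Suc (degree (V p)) = degree v" if "p \<in> ?S" for p
    using V0[OF that] by (subst V[OF that], subst degree_mult_eq) auto
  have leadV: "coeff (V p) (degree v - 1) = lead_coeff v" if "p \<in> ?S" for p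
  proof -
    have "lead_coeff v = lead_coeff ([:- p, 1:] * V p)" by (rule arg_cong[OF V[OF that]])
    then have "lead_coeff v = lead_coeff (V p)" unfolding lead_coeff_mult by simp
    then show ?thesis using degV[OF that] by (metis diff_Suc_1)
  qed
  have V_same: "coeff (shift_poly p (V p)) j = coeff (shift_poly p v) (Suc j)" if "p \<in> ?S" for p j
  proof -
    have "shift_poly p v = shift_poly p [:- p, 1:] * shift_poly p (V p)"
      by (metis V[OF that] pcompose_mult)
    then show ?thesis by (simp add: pcompose_pCons)
  qed
  have V_other: "coeff (shift_poly p (V p')) j = 0"
    if "p \<in> ?S" "p' \<in> ?S" "p \<noteq> p'" "j < order p v" for p p' j
  proof -
    have "order p v = order p [:- p', 1:] + order p (V p')"
      by (metis V[OF that(2)] order_mult v)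
    also have "order p [:- p', 1:] = 0" using that(3) by (intro order_0I) simp
    finally show ?thesis using coeff_shift_order(1)[OF V0[OF that(2)]] that(4) by simp
  qed
  define w where "w = u - (\<Sum>p\<in>?S. smult (\<rho> p) (V p))"
  have shift_sum: "shift_poly p (\<Sum>q\<in>I. f q) = (\<Sum>q\<in>I. shift_poly p (f q))" for p f and I :: "complex set"
    by (induction I rule: infinite_finite_induct) (simp_all add: pcompose_add)
  have "[:- p, 1:] ^ order p v dvd w" if p: "p \<in> ?S" for p
  proof -
    have "coeff (shift_poly p w) j = 0" if j: "j < order p v" for j
    proof -
      have "coeff (shift_poly p w) j
          = coeff (shift_poly p u) j - (\<Sum>q\<in>?S. \<rho> q * coeff (shift_poly p (V q)) j)"
        by (simp add: w_def pcompose_diff shift_sum coeff_sum pcompose_smult)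
      also have "(\<Sum>q\<in>?S. \<rho> q * coeff (shift_poly p (V q)) j) = \<rho> p * coeff (shift_poly p (V p)) j"
        using V_other[OF p _ _ j] by (subst sum.remove[OF fin p]) (simp, intro sum.neutral, force)
      also have "\<dots> = \<rho> p * coeff (shift_poly p v) (Suc j)" using V_same[OF p] by simp
      also have "coeff (shift_poly p u) j - \<dots> = 0"
      proof (cases "Suc j < order p v")
        case True
        then show ?thesis using simple[of p j] coeff_shift_order(1)[OF v True] p by simp
      next
        case False
        then have "Suc j = order p v" using j by simp
        moreover have "order p v - 1 = j" using calculation by simp
        ultimately show ?thesis using coeff_shift_order(2)[OF v, of p] by (simp add: \<rho>_def)
      qed
      finally show ?thesis .
    qed
    then show ?thesis using linear_power_dvd_iff_coeff_shift by blast
  qed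
  then have ord: "order p v \<le> order p w" if "w \<noteq> 0" for p
    using that v by (cases "p \<in> ?S") (auto simp: order_divides order_0I)
  have "w = 0"
  proof (rule ccontr)
    assume w0: "w \<noteq> 0"
    then have "proots v \<subseteq># proots w" using ord v by (intro mset_subset_eqI) simp
    then have "degree v \<le> degree w" using size_mset_mono size_proots_complex by metis
    moreover have "degree w < degree v"
    proof -
      have "degree (\<Sum>p\<in>?S. smult (\<rho> p) (V p)) < degree v"
        using deg
        by (intro degree_sum_less le_less_trans[OF degree_smult_le])
           (use degV in \<open>force simp: less_eq_Suc_le\<close>)+
      then show ?thesis unfolding w_def using deg by (intro degree_diff_less) auto
    qed
    ultimately show False by simp
  qed
  then have "u = (\<Sum>p\<in>?S. smult (\<rho> p) (V p))" by (simp add: w_def)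
  then have "coeff u (degree v - 1) = (\<Sum>p\<in>?S. \<rho> p * lead_coeff v)"
    using leadV by (simp add: coeff_sum)
  then have "coeff u (degree v - 1) = (\<Sum>p\<in>?S. \<rho> p) * lead_coeff v"
    by (simp only: sum_distrib_right)
  then have "(\<Sum>p\<in>?S. \<rho> p) = coeff u (degree v - 1) / lead_coeff v"
    using v by simp
  then show ?thesis by (simp only: \<rho>_def)
qed

text \<open>
  Translation of \<open>p\<close> to the origin, which carries the notions at \<open>0\<close> over to any finite point.
\<close>

definition shift_op :: "complex \<Rightarrow> complex poly poly \<Rightarrow> complex poly poly" where
  "shift_op p \<beta> = map_poly (shift_poly p) \<beta>"

lemma coeff_shift_op: "coeff (shift_op p \<beta>) i = shift_poly p (coeff \<beta> i)"
  by (simp add: shift_op_def coeff_map_poly)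

lemma degree_shift_op: "degree (shift_op p \<beta>) = degree \<beta>"
  unfolding shift_op_def by (rule degree_map_poly) (simp add: pcompose_eq_0_iff)

lemma act_shift_op: "act (shift_op p \<beta>) (shift_poly p f) = shift_poly p (act \<beta> f)"
proof -
  have d: "(pderiv ^^ i) (shift_poly p f) = shift_poly p ((pderiv ^^ i) f)" for i
    by (induction i) (simp_all add: pderiv_pcompose pderiv_pCons)
  have "shift_poly p (\<Sum>q\<in>I. g q) = (\<Sum>q\<in>I. shift_poly p (g q))" for g and I :: "nat set"
    by (induction I rule: infinite_finite_induct) (simp_all add: pcompose_add)
  then show ?thesis
    by (simp add: act_def degree_shift_op coeff_shift_op d pcompose_mult)
qed

lemma sum_proots:
  assumes "degree (f :: complex poly) = Suc k"
  shows "sum_mset (proots f) = - coeff f k / lead_coeff f"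
proof -
  have *: "coeff (\<Prod>x\<in>#M. [:- x, 1:]) (size M) = 1 \<and>
     (size M = Suc k \<longrightarrow> coeff (\<Prod>x\<in>#M. [:- x, 1:]) k = - sum_mset M)" for k and M :: "complex multiset"
  proof (induction M arbitrary: k)
    case (add x M)
    have nz: "(\<Prod>x\<in>#M. [:- x, 1:]) \<noteq> 0" for M :: "complex multiset"
      by (auto simp: prod_mset_zero_iff)
    have d: "degree (\<Prod>x\<in>#M. [:- x, 1:]) = size M"
    proof (induction M)
      case (add y M)
      have "degree ([:- y, 1:] * (\<Prod>x\<in>#M. [:- x, 1:])) = 1 + size M"
        by (subst degree_mult_eq[OF _ nz]) (use add in auto)
      then show ?case by simp
    qed simp
    have c: "coeff (\<Prod>x\<in>#M. [:- x, 1:]) (Suc (size M)) = 0"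
      by (rule coeff_eq_0) (simp add: d)
    show ?case
    proof (cases "size M")
      case 0
      then show ?thesis by simp
    next
      case (Suc j)
      then show ?thesis using add.IH[of j] c by auto
    qed
  qed simp
  let ?P = "\<Prod>x\<in>#proots f. [:- x, 1:]"
  have "f = smult (lead_coeff f) ?P" using complex_poly_decompose_multiset[of f] by (rule sym)
  then have "coeff f k = lead_coeff f * coeff ?P k" by (metis coeff_smult)
  moreover have "coeff ?P k = - sum_mset (proots f)"
    using *[of "proots f" k] size_proots_complex[of f] assms by simp
  moreover have "lead_coeff f \<noteq> 0" using assms by (metis Zero_not_Suc degree_0 leading_coeff_0_iff)
  ultimately show ?thesis by simp
qed

text \<open>
  Summing \<open>x \<ge> \<tau> - max 0 (\<tau> - x)\<close> over \<open>A\<close> and extending the sum of the maxima to \<open>B\<close> only weakens it. With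
  \<open>\<tau>\<close> near the \<open>size A\<close>-th smallest element of \<open>B\<close> the bound is the sum of the smallest elements,
  so no choice of a subset has to be discussed.
\<close>

lemma sum_subset_lower_bound:
  fixes \<tau> :: real
  assumes "A \<subseteq># B"
  shows "of_nat (size A) * \<tau> - (\<Sum>x\<in>#B. max 0 (\<tau> - Re x)) \<le> Re (sum_mset A)"
proof -
  have 1: "of_nat (size A) * \<tau> - (\<Sum>x\<in>#A. max 0 (\<tau> - Re x)) \<le> Re (sum_mset A)"
    by (induction A) (auto simp: algebra_simps max_def)
  obtain C where "B = A + C" using assms by (auto simp: mset_subset_eq_exists_conv)
  moreover have "0 \<le> (\<Sum>x\<in>#C. max 0 (\<tau> - Re x))" by (induction C) auto
  ultimately show ?thesis using 1 by simp
qed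

lemma proots_mono: "f dvd g \<Longrightarrow> (g :: complex poly) \<noteq> 0 \<Longrightarrow> proots f \<subseteq># proots g"
  by (auto simp: proots_mult elim!: dvdE)

text \<open>
  The two leading coefficients of \<open>\<beta>\<close> carry the sum of the exponents: \<open>(\<theta>)\<^sub>k\<^sub>+\<^sub>1\<close> contributes
  \<open>k (k + 1) / 2\<close> to the sum of the roots and the quotient of the two coefficients the rest.
\<close>

lemma extremal_leading_coeffs:
  assumes deg: "degree \<beta> = Suc k" and "extremal \<sigma> \<beta> w" and "degree (indicial \<beta> w) = Suc k"
  shows "int_coeff (coeff \<beta> (Suc k)) (int (Suc k) + w) \<noteq> 0"
    and "\<sigma> * w' < \<sigma> * w \<Longrightarrow> int_coeff (coeff \<beta> (Suc k)) (int (Suc k) + w') = 0"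
    and "\<sigma> * w' < \<sigma> * w \<Longrightarrow> int_coeff (coeff \<beta> k) (int k + w') = 0"
    and "sum_mset (proots (indicial \<beta> w)) = of_nat k * of_nat (Suc k) / 2
      - int_coeff (coeff \<beta> k) (int k + w) / int_coeff (coeff \<beta> (Suc k)) (int (Suc k) + w)"
proof -
  have top: "coeff (indicial \<beta> w) (Suc k) = int_coeff (coeff \<beta> (Suc k)) (int (Suc k) + w)" for w
    using coeff_indicial_top[of \<beta> w] deg by simp
  have "coeff (indicial \<beta> w) (Suc k) \<noteq> 0"
    using assms(3) by (metis Zero_not_Suc degree_0 leading_coeff_0_iff)
  then show nz: "int_coeff (coeff \<beta> (Suc k)) (int (Suc k) + w) \<noteq> 0"
    by (simp only: top not_False_eq_True)
  have 0: "indicial \<beta> w' = 0" if "\<sigma> * w' < \<sigma> * w" for w'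
    using assms(2) that unfolding extremal_def by fastforce
  show 1: "int_coeff (coeff \<beta> (Suc k)) (int (Suc k) + w') = 0" if "\<sigma> * w' < \<sigma> * w" for w'
    using top[of w'] 0[OF that] by simp
  show "int_coeff (coeff \<beta> k) (int k + w') = 0" if "\<sigma> * w' < \<sigma> * w" for w'
    using coeff_indicial_next[OF deg, of w'] 0[OF that] 1[OF that] by simp
  show "sum_mset (proots (indicial \<beta> w)) = of_nat k * of_nat (Suc k) / 2
      - int_coeff (coeff \<beta> k) (int k + w) / int_coeff (coeff \<beta> (Suc k)) (int (Suc k) + w)"
    using sum_proots[OF assms(3)] coeff_indicial_next[OF deg, of w] nz assms(3) top[of w]
    by (simp add: field_simps)
qed


section \<open>The Fuchs relation for a right factor\<close>

lemma degree_eq_Suc_imp_nonzero: "degree \<beta> = Suc k \<Longrightarrow> \<beta> \<noteq> 0"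
  by auto

lemma shift_op_eq_0_iff: "shift_op p \<beta> = 0 \<longleftrightarrow> \<beta> = 0"
  by (simp add: poly_eq_iff[of _ "0 :: complex poly poly"] coeff_shift_op pcompose_eq_0_iff)

text \<open>
  For a regular singular operator the quotient \<open>u / v\<close> of the two leading coefficients has at most a
  simple pole at \<open>p\<close>, and its residue is \<open>k (k + 1) / 2\<close> minus the sum of the exponents.
\<close>

lemma local_residue:
  assumes deg: "degree \<beta> = Suc k" and ext: "extremal 1 (shift_op p \<beta>) w"
    and reg: "degree (indicial (shift_op p \<beta>) w) = Suc k"
  defines "v \<equiv> coeff \<beta> (Suc k)" and "u \<equiv> coeff \<beta> k"
  shows "Suc j < order p v \<Longrightarrow> coeff (shift_poly p u) j = 0"
    and "poly v p = 0 \<Longrightarrow> sum_mset (proots (indicial (shift_op p \<beta>) w)) =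
      of_nat k * of_nat (Suc k) / 2
        - coeff (shift_poly p u) (order p v - 1) / coeff (shift_poly p v) (order p v)"
proof -
  have deg': "degree (shift_op p \<beta>) = Suc k" using deg by (simp add: degree_shift_op)
  note lc = extremal_leading_coeffs[OF deg' ext reg, unfolded coeff_shift_op,
      folded v_def u_def, simplified]
  have v0: "v \<noteq> 0" using deg by (metis leading_coeff_0_iff degree_eq_Suc_imp_nonzero v_def)
  have nn: "int (Suc k) + w \<ge> 0" using lc(1) by (auto simp: int_coeff_def split: if_splits)
  define e where "e = nat (int (Suc k) + w)"
  have e: "w = int e - int (Suc k)" using nn by (simp add: e_def)
  have ne: "coeff (shift_poly p v) e \<noteq> 0" using lc(1) nn by (simp add: e int_coeff_def)
  have below: "coeff (shift_poly p v) j = 0" if "j < e" for j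
    using lc(2)[of "int j - int (Suc k)"] that by (simp add: e int_coeff_def)
  have ord: "order p v = e"
    using ne below coeff_shift_order[OF v0, where p = p] by (metis linorder_neqE_nat)
  show "coeff (shift_poly p u) j = 0" if "Suc j < order p v"
    using lc(3)[of "int j - int k"] that unfolding ord by (simp add: e int_coeff_def)
  assume "poly v p = 0"
  then have "e > 0" using v0 ord order_root by (metis gr0I)
  then have "nat (int k + w) = e - 1" "int k + w \<ge> 0" "nat (1 + int k + w) = e" "\<not> 1 + int k + w < 0"
    by (simp_all add: e)
  then show "sum_mset (proots (indicial (shift_op p \<beta>) w)) =
      of_nat k * of_nat (Suc k) / 2
        - coeff (shift_poly p u) (order p v - 1) / coeff (shift_poly p v) (order p v)"
    using lc(4) unfolding ord by (simp add: int_coeff_def)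
qed

text \<open>
  The exponents of a right factor at \<open>p\<close> are some of those of \<open>L\<close>, so lower bounds for sums of
  exponents of \<open>L\<close> give upper bounds for the residue.
\<close>

lemma residue_bound:
  assumes h: "h \<noteq> 0" and \<alpha>: "\<alpha> \<noteq> 0" and deg\<beta>: "degree \<beta> = Suc k"
    and comp: "\<And>f. h * act L f = act \<alpha> (act \<beta> f)"
    and deg: "degree L = degree \<alpha> + Suc k"
    and ext: "extremal 1 (shift_op p L) w"
    and reg: "degree (indicial (shift_op p L) w) = degree L"
  defines "v \<equiv> coeff \<beta> (Suc k)" and "u \<equiv> coeff \<beta> k"
  shows "Suc j < order p v \<Longrightarrow> coeff (shift_poly p u) j = 0"
    and "poly v p = 0 \<Longrightarrow>
      Re (coeff (shift_poly p u) (order p v - 1) / coeff (shift_poly p v) (order p v))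
        \<le> of_nat k * of_nat (Suc k) / 2 - of_nat (Suc k) * \<tau>
          + (\<Sum>x\<in>#proots (indicial (shift_op p L) w). max 0 (\<tau> - Re x))"
proof -
  have "act (shift_op p L) f = shift_poly p (act L (shift_poly (- p) f))" for L f
    using act_shift_op[of p L "shift_poly (- p) f"] shift_poly_inverse[of f "- p"] by simp
  then have "shift_poly p h * act (shift_op p L) f = act (shift_op p \<alpha>) (act (shift_op p \<beta>) f)" for f
    using comp by (simp add: shift_poly_inverse act_shift_op flip: pcompose_mult)
  moreover have "shift_poly p h \<noteq> 0" using h by (simp add: pcompose_eq_0_iff)
  moreover have "shift_op p \<alpha> \<noteq> 0" "shift_op p \<beta> \<noteq> 0"
    using \<alpha> deg\<beta> degree_eq_Suc_imp_nonzero by (auto simp: shift_op_eq_0_iff)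
  ultimately obtain b where b: "extremal 1 (shift_op p \<beta>) b"
      "degree (indicial (shift_op p \<beta>) b) = Suc k"
      "indicial (shift_op p \<beta>) b dvd indicial (shift_op p L) w"
    using right_factor_indicial[of 1 "shift_poly p h" "shift_op p \<alpha>" "shift_op p \<beta>" "shift_op p L" w]
      deg ext reg deg\<beta> by (auto simp: degree_shift_op)
  note lr = local_residue[OF deg\<beta> b(1,2), folded u_def v_def]
  show "Suc j < order p v \<Longrightarrow> coeff (shift_poly p u) j = 0" by (rule lr(1))
  assume "poly v p = 0"
  note s = lr(2)[OF this]
  have "indicial (shift_op p L) w \<noteq> 0" using ext by (simp add: extremal_def)
  then have "proots (indicial (shift_op p \<beta>) b) \<subseteq># proots (indicial (shift_op p L) w)"
    using b(3) proots_mono by blast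
  from sum_subset_lower_bound[OF this, of \<tau>] b(2)
  have "of_nat (Suc k) * \<tau> - (\<Sum>x\<in>#proots (indicial (shift_op p L) w). max 0 (\<tau> - Re x))
     \<le> Re (sum_mset (proots (indicial (shift_op p \<beta>) b)))" by (simp add: size_proots_complex)
  moreover have "Re (of_nat k * of_nat (Suc k) / 2) = of_nat k * of_nat (Suc k) / 2"
    by (metis Re_complex_of_real of_real_divide of_real_mult of_real_numeral of_real_of_nat_eq)
  ultimately show "Re (coeff (shift_poly p u) (order p v - 1) / coeff (shift_poly p v) (order p v))
        \<le> of_nat k * of_nat (Suc k) / 2 - of_nat (Suc k) * \<tau>
          + (\<Sum>x\<in>#proots (indicial (shift_op p L) w). max 0 (\<tau> - Re x))"
    unfolding s by simp
qed

lemma coeff_shift_poly_0: "coeff (shift_poly p f) 0 = poly f p"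
  by (simp add: poly_0_coeff_0[symmetric] poly_pcompose)

lemma coeff_shift_poly_1: "coeff (shift_poly p f) 1 = poly (pderiv f) p"
proof -
  have "coeff (shift_poly p f) 1 = coeff (pderiv (shift_poly p f)) 0" by (simp add: coeff_pderiv)
  then show ?thesis by (simp add: pderiv_pcompose pderiv_pCons coeff_shift_poly_0)
qed

text \<open>
  At a point where the leading coefficient does not vanish only the weight \<open>- n\<close> matters, at a simple
  zero of it the weight \<open>1 - n\<close>.
\<close>

lemma indicial_lowest:
  assumes "degree L = n"
  shows "w < - int n \<Longrightarrow> indicial L w = 0"
    and "indicial L (- int n) = smult (coeff (coeff L n) 0) (falling_poly n)"
    and "n = Suc m \<Longrightarrow> indicial L (1 - int n) =
      smult (coeff (coeff L n) 1) (falling_poly n) + smult (coeff (coeff L m) 0) (falling_poly m)"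
proof -
  show "w < - int n \<Longrightarrow> indicial L w = 0"
    by (simp add: indicial_def int_coeff_def assms)
  have "indicial L (- int n) = (\<Sum>i\<le>n. if i = n then smult (coeff (coeff L n) 0) (falling_poly n) else 0)"
    unfolding indicial_def assms by (intro sum.cong) (auto simp: int_coeff_def)
  then show "indicial L (- int n) = smult (coeff (coeff L n) 0) (falling_poly n)" by simp
  assume n: "n = Suc m"
  have "(\<Sum>i\<le>m. smult (int_coeff (coeff L i) (int i + (1 - int n))) (falling_poly i)) =
     (\<Sum>i\<le>m. if i = m then smult (coeff (coeff L m) 0) (falling_poly m) else 0)"
    by (intro sum.cong) (auto simp: int_coeff_def n)
  then show "indicial L (1 - int n) =
      smult (coeff (coeff L n) 1) (falling_poly n) + smult (coeff (coeff L m) 0) (falling_poly m)"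
    unfolding indicial_def assms by (simp add: n int_coeff_def)
qed

lemma proots_falling_poly: "proots (falling_poly n) = image_mset of_nat (mset_set {..<n})"
proof (induction n)
  case 0
  then show ?case by (simp add: falling_poly_def)
next
  case (Suc n)
  have "falling_poly n \<noteq> 0" by (metis coeff_0 coeff_falling_poly_top zero_neq_one)
  then have "proots (falling_poly (Suc n)) = proots (falling_poly n) + proots [:- of_nat n, 1:]"
    unfolding falling_poly_Suc by (intro proots_mult) simp_all
  then show ?case using Suc by (simp add: lessThan_Suc)
qed

lemma sum_positive_parts:
  assumes "k < n"
  shows "(\<Sum>x\<in>#proots (falling_poly n). max 0 (real k - Re x)) = real k * real (Suc k) / 2"
proof -
  have "(\<Sum>x\<in>#proots (falling_poly n). max 0 (real k - Re x)) = (\<Sum>j<n. max 0 (real k - real j))"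
    by (simp add: proots_falling_poly sum_unfold_sum_mset multiset.map_comp comp_def)
  also have "\<dots> = (\<Sum>j<Suc k. real k - real j)"
    using assms by (intro sum.mono_neutral_cong_right) auto
  also have "\<dots> = real k * real (Suc k) / 2"
  proof -
    have *: "(\<Sum>j<m. c - real j) = real m * c - real m * (real m - 1) / 2" for m c
      by (induction m) (simp_all add: field_simps)
    show ?thesis unfolding *[of "real k" "Suc k"] by (simp add: field_simps)
  qed
  finally show ?thesis .
qed

text \<open>
  The hypotheses \<open>lead\<close> and \<open>sub\<close> describe a self-adjoint shape: with \<open>n = m + 1\<close> the exponents are
  \<open>0, ..., n - 1\<close> at a point outside \<open>0\<close> and the roots of \<open>q\<close>, and \<open>0, ..., n - 2, (n - 2) / 2\<close> at a
  nonzero root of \<open>q\<close>. A factor of order \<open>k + 1\<close> has residue at most \<open>k (k + 1) / 2\<close> at \<open>0\<close>, at most \<open>0\<close> at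
  the former points, and it can exceed \<open>0\<close> at the latter only by using the exceptional exponent.
  Summing all residues bounds the exponents at infinity from above; in the conclusion they appear
  with opposite sign, as roots of the indicial polynomial.
\<close>

lemma fuchs_inequality:
  fixes q :: "complex poly" and k m :: nat
  assumes degL: "degree L = Suc m"
    and lead: "coeff L (Suc m) = monom 1 (Suc m) * q"
    and sub: "coeff L m = monom 1 m * (smult (of_nat m * of_nat (Suc m) / 2) q
      + smult (of_nat (Suc m) / 2) ([:0, 1:] * pderiv q))"
    and q0: "q \<noteq> 0" and simple: "\<And>p. poly q p = 0 \<Longrightarrow> poly (pderiv q) p \<noteq> 0"
    and zero: "extremal 1 L 0" "indicial L 0 = monom 1 (Suc m)"
    and inf: "extremal (-1) L r" "degree (indicial L r) = Suc m"
    and h: "h \<noteq> 0" and \<alpha>: "\<alpha> \<noteq> 0" and deg\<beta>: "degree \<beta> = Suc k"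
    and comp: "\<And>f. h * act L f = act \<alpha> (act \<beta> f)"
    and deg: "degree L = degree \<alpha> + Suc k" and km: "k < m"
  obtains A where "A \<subseteq># proots (indicial L r)" "size A = Suc k"
    "- (real (degree q) * max 0 (real k - (real m - 1) / 2)) \<le> Re (sum_mset A)"
proof -
  define u v where "u = coeff \<beta> k" and "v = coeff \<beta> (Suc k)"
  define M where "M = max 0 (real k - (real m - 1) / 2)"
  define c where "c = real k * real (Suc k) / 2"
  define bnd where "bnd p = (if p = 0 then c else 0) + (if poly q p = 0 then M else 0)" for p
  define \<rho> where "\<rho> p = coeff (shift_poly p u) (order p v - 1)
      / coeff (shift_poly p v) (order p v)" for p
  have M0: "M \<ge> 0" and c0: "c \<ge> 0" by (simp_all add: M_def c_def)
  have v0: "v \<noteq> 0" using deg\<beta> by (metis leading_coeff_0_iff degree_eq_Suc_imp_nonzero v_def)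
  note rb1 = residue_bound(1)[OF h \<alpha> deg\<beta> comp deg, folded u_def v_def]
  note rb2 = residue_bound(2)[OF h \<alpha> deg\<beta> comp deg, folded u_def v_def c_def]
  have loc: "(Suc j < order p v \<longrightarrow> coeff (shift_poly p u) j = 0) \<and>
      (poly v p = 0 \<longrightarrow> Re (\<rho> p) \<le> bnd p)" for p j
  proof (cases "p = 0")
    case True
    have s0: "shift_op 0 L = L"
      by (rule poly_eqI) (simp add: coeff_shift_op)
    have "(\<Sum>x\<in>#repeat_mset i {#0#}. max 0 (0 - Re x)) = 0" for i
      by (induction i) auto
    moreover have "proots (monom 1 (Suc m) :: complex poly) = repeat_mset (Suc m) {#0#}"
      by (simp only: monom_altdef smult_1_left proots_power proots_linear_factor) simp
    ultimately have "(\<Sum>x\<in>#proots (indicial L 0). max 0 (0 - Re x)) = 0"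
      by (simp only: zero(2))
    then show ?thesis
      using rb1[of 0 0 j] rb2[of 0 0 0] zero(1) M0 degL unfolding True
      by (auto simp: s0 zero(2) degree_monom_eq bnd_def \<rho>_def)
  next
    case False
    have lead_p: "coeff (shift_poly p (coeff L (Suc m))) 0 = p ^ Suc m * poly q p"
      by (simp only: coeff_shift_poly_0) (simp add: lead poly_monom)
    note low = indicial_lowest[OF degL[folded degree_shift_op[of p L]], unfolded coeff_shift_op]
    show ?thesis
    proof (cases "poly q p = 0")
      case ordinary: False
      have ind: "indicial (shift_op p L) (- int (Suc m)) = smult (p ^ Suc m * poly q p) (falling_poly (Suc m))"
        using low(2) unfolding lead_p .
      have nz: "p ^ Suc m * poly q p \<noteq> 0" using False ordinary by simp
      \<comment> \<open>At the threshold \<open>k\<close> the bound for the residue is exactly \<open>0\<close>.\<close>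
      have ext: "extremal 1 (shift_op p L) (- int (Suc m))"
        unfolding extremal_def using ind nz low(1) not_le
        by (metis coeff_0 coeff_falling_poly_top mult_1 smult_eq_0_iff zero_neq_one)
      have pr: "proots (indicial (shift_op p L) (- int (Suc m))) = proots (falling_poly (Suc m))"
        using nz unfolding ind by (rule proots_smult)
      have reg: "degree (indicial (shift_op p L) (- int (Suc m))) = degree L"
        unfolding ind using nz degL by (simp add: degree_falling_poly)
      have "c - real (Suc k) * real k + c = 0" by (simp add: c_def)
      then show ?thesis
        using rb1[OF ext reg, of j] rb2[OF ext reg, of "real k"] sum_positive_parts[of k "Suc m"] km
          False ordinary
        unfolding pr by (auto simp: bnd_def \<rho>_def c_def)
    next
      case conifold: True
      define d where "d = p ^ Suc m * poly (pderiv q) p"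
      have nz: "d \<noteq> 0" using False simple[OF conifold] by (simp add: d_def)
      have 1: "coeff (shift_poly p (coeff L (Suc m))) 1 = d"
        by (simp only: coeff_shift_poly_1) (simp add: lead pderiv_mult conifold poly_monom d_def)
      have 0: "coeff (shift_poly p (coeff L m)) 0 = of_nat (Suc m) / 2 * d"
        by (simp only: coeff_shift_poly_0) (simp add: sub conifold poly_monom d_def)
      have ind: "indicial (shift_op p L) (1 - int (Suc m))
          = smult d (falling_poly m * [:- ((of_nat m - 1) / 2), 1:])"
      proof -
        have "smult d (f * [:- of_nat m, 1:]) + smult e f = f * (smult d [:- of_nat m, 1:] + [:e:])"
          for e and f :: "complex poly"
          by (rule poly_eqI) (simp add: coeff_pCons algebra_simps split: nat.split)
        moreover have "smult d [:- of_nat m, 1:] + [:of_nat (Suc m) / 2 * d:]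
            = smult d [:- ((of_nat m - 1) / 2), 1:]"
          by (simp add: field_simps)
        ultimately show ?thesis
          using low(3)[OF refl] unfolding 1 0 falling_poly_Suc by (simp only: mult_smult_right)
      qed
      have ff0: "falling_poly m \<noteq> 0" by (metis coeff_0 coeff_falling_poly_top zero_neq_one)
      have zero': "indicial (shift_op p L) w = 0" if "w < 1 - int (Suc m)" for w
        using low(1)[of w] low(2) lead_p conifold that by (cases "w = - int (Suc m)") auto
      have ext: "extremal 1 (shift_op p L) (1 - int (Suc m))"
        unfolding extremal_def using ind nz ff0 zero' not_le
        by (metis mult_1 mult_eq_0_iff one_neq_zero pCons_eq_0_iff smult_eq_0_iff)
      \<comment> \<open>The exceptional exponent is \<open>(m - 1) / 2\<close>; at threshold \<open>k\<close> it costs \<open>max 0 (k - (m - 1) / 2)\<close>.\<close>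
      have pr: "proots (indicial (shift_op p L) (1 - int (Suc m)))
          = proots (falling_poly m) + {#(of_nat m - 1) / 2#}"
        unfolding ind proots_smult[OF nz] by (subst proots_mult) (simp_all add: ff0)
      have reg: "degree (indicial (shift_op p L) (1 - int (Suc m))) = degree L"
        unfolding ind using nz degL ff0 by (simp add: degree_mult_eq degree_falling_poly del: mult_pCons_right)
      have "c - real (Suc k) * real k + c = 0" by (simp add: c_def)
      moreover have "Re ((of_nat m - 1) / 2) = (real m - 1) / 2" by simp
      ultimately show ?thesis
        using rb1[OF ext reg, of j] rb2[OF ext reg, of "real k"] sum_positive_parts[of k m] km
          False conifold
        unfolding pr by (auto simp: bnd_def \<rho>_def c_def M_def)
    qed
  qed
  let ?S = "{p. poly v p = 0}" and ?Q = "{p. poly q p = 0}"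
  have fin: "finite ?S" "finite ?Q" using v0 q0 by (auto intro: poly_roots_finite)
  \<comment> \<open>The bounds are nonnegative, so the points \<open>0\<close> and the roots of \<open>q\<close> may be added.\<close>
  have "(\<Sum>p\<in>?S. Re (\<rho> p)) \<le> (\<Sum>p\<in>?S. bnd p)"
    using loc by (intro sum_mono) auto
  also have "\<dots> \<le> (\<Sum>p\<in>insert 0 (?S \<union> ?Q). bnd p)"
    using fin M0 c0 by (intro sum_mono2) (auto simp: bnd_def)
  also have "\<dots> = c + (\<Sum>p\<in>insert 0 (?S \<union> ?Q). if poly q p = 0 then M else 0)"
    using fin by (simp add: bnd_def sum.distrib)
  also have "(\<Sum>p\<in>insert 0 (?S \<union> ?Q). if poly q p = 0 then M else 0) = (\<Sum>p\<in>?Q. M)"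
    using fin by (intro sum.mono_neutral_cong_right) auto
  also have "\<dots> = real (card ?Q) * M" by simp
  also have "\<dots> \<le> real (degree q) * M"
    using M0 card_poly_roots_bound[OF q0] by (intro mult_right_mono) auto
  finally have up: "(\<Sum>p\<in>?S. Re (\<rho> p)) \<le> c + real (degree q) * M" by simp

  \<comment> \<open>At infinity the same quotient of coefficients is read off from the highest weight.\<close>
  obtain w where w: "extremal (-1) \<beta> w" "degree (indicial \<beta> w) = Suc k"
      "indicial \<beta> w dvd indicial L r"
    using right_factor_indicial[of "-1" h \<alpha> \<beta> L r] h \<alpha> comp deg inf degL deg\<beta>
      degree_eq_Suc_imp_nonzero[OF deg\<beta>] by auto
  note lc = extremal_leading_coeffs[OF deg\<beta> w(1,2), folded u_def v_def]
  have nn: "int (Suc k) + w \<ge> 0" using lc(1) by (auto simp: int_coeff_def split: if_splits)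
  define e where "e = nat (int (Suc k) + w)"
  have e: "w = int e - int (Suc k)" using nn by (simp add: e_def)
  have ne: "coeff v e \<noteq> 0" using lc(1) nn by (simp add: e int_coeff_def)
  have above: "coeff v j = 0" if "j > e" for j
    using lc(2)[of "int j - int (Suc k)"] that by (simp add: e int_coeff_def)
  have above_u: "coeff u j = 0" if "Suc j > e" for j
    using lc(3)[of "int j - int k"] that by (simp add: e int_coeff_def)
  have dv: "degree v = e" using ne above by (meson le_degree leading_coeff_0_iff linorder_not_less order_antisym v0 leI)
  have "Re (int_coeff u (int k + w) / int_coeff v (int (Suc k) + w)) \<le> c + real (degree q) * M"
  \<comment> \<open>For constant \<open>v\<close> there are no residues, and regularity at infinity forces \<open>u = 0\<close>.\<close>
  proof (cases "e = 0")
    case True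
    then have "int_coeff u (int k + w) = 0" by (simp add: e int_coeff_def)
    then show ?thesis using c0 M0 by simp
  next
    case False
    have "degree u \<le> e - 1" using above_u False by (intro degree_le) auto
    then have "degree u < degree v" using dv False by simp
    then have "(\<Sum>p\<in>?S. \<rho> p) = coeff u (degree v - 1) / lead_coeff v"
      unfolding \<rho>_def using v0 loc by (intro sum_residues) auto
    then have "Re (coeff u (e - 1) / coeff v e) \<le> c + real (degree q) * M"
      using up by (simp add: dv flip: Re_sum)
    moreover have "int_coeff u (int k + w) = coeff u (e - 1)" "int_coeff v (int (Suc k) + w) = coeff v e"
      using False by (simp_all add: int_coeff_def e nat_diff_distrib')
    ultimately show ?thesis by simp
  qed
  moreover have "Re (of_nat k * of_nat (Suc k) / 2) = c"
    by (metis Re_complex_of_real of_real_divide of_real_mult of_real_numeral of_real_of_nat_eq c_def)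
  ultimately have "- (real (degree q) * M) \<le> Re (sum_mset (proots (indicial \<beta> w)))"
    unfolding lc(4) by simp
  moreover have "proots (indicial \<beta> w) \<subseteq># proots (indicial L r)"
    using w(3) inf by (intro proots_mono) (auto simp: extremal_def)
  moreover have "size (proots (indicial \<beta> w)) = Suc k"
    by (simp add: size_proots_complex w(2))
  ultimately show ?thesis using that unfolding M_def by blast
qed


section \<open>From rational to polynomial coefficients\<close>

definition poly_diffop :: "complex poly poly \<Rightarrow> diffop" where
  "poly_diffop \<alpha> = Diffop (map_poly to_fract \<alpha>)"

lemma diffop_poly_poly_diffop [simp]: "diffop_poly (poly_diffop \<alpha>) = map_poly to_fract \<alpha>"
  by (simp add: poly_diffop_def)

lemma diffop_order_poly_diffop: "diffop_order (poly_diffop \<alpha>) = degree \<alpha>"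
  unfolding diffop_order_def diffop_poly_poly_diffop by (rule degree_map_poly) simp

lemma map_to_fract_add: "map_poly to_fract (p + q) = map_poly to_fract p + map_poly to_fract q"
  by (rule poly_eqI) (simp add: coeff_map_poly)

lemma map_to_fract_smult: "map_poly to_fract (smult a p) = smult (to_fract a) (map_poly to_fract p)"
  by (rule poly_eqI) (simp add: coeff_map_poly)

lemma map_to_fract_sum:
  "map_poly to_fract (\<Sum>i\<in>I. f i) = (\<Sum>i\<in>I. map_poly to_fract (f i))"
  by (induction I rule: infinite_finite_induct) (simp_all add: map_to_fract_add)

lemma poly_diffop_add: "poly_diffop \<alpha> + poly_diffop \<beta> = poly_diffop (\<alpha> + \<beta>)"
  by (rule diffop_eqI) (simp add: plus_diffop.rep_eq map_to_fract_add)

lemma poly_diffop_mult: "\<exists>\<gamma>. poly_diffop \<alpha> * poly_diffop \<beta> = poly_diffop \<gamma>"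
proof -
  define D where "D q = pCons 0 q + map_poly pderiv q" for q :: "complex poly poly"
  have "D_left (map_poly to_fract q) = map_poly to_fract (D q)" for q
    unfolding D_left_def D_def map_to_fract_add
    by (rule arg_cong2[where f = "(+)"]) (rule poly_eqI, simp add: coeff_map_poly coeff_pCons split: nat.split)+
  then have pow: "(D_left ^^ i) (map_poly to_fract q) = map_poly to_fract ((D ^^ i) q)" for i q
    by (induction i) simp_all
  have "diffop_poly (poly_diffop \<alpha> * poly_diffop \<beta>) =
      map_poly to_fract (\<Sum>i\<le>degree \<alpha>. smult (coeff \<alpha> i) ((D ^^ i) \<beta>))"
    using diffop_order_poly_diffop[of \<alpha>]
    by (simp add: times_diffop.rep_eq skew_times_def diffop_order_def pow coeff_map_poly
        map_to_fract_sum map_to_fract_smult)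
  then show ?thesis by (metis diffop_eqI diffop_poly_poly_diffop)
qed

lemma poly_diffop_basic:
  "z_op = poly_diffop [:[:0, 1:]:]" "D_op = poly_diffop [:0, 1:]" "const_op c = poly_diffop [:[:c:]:]"
  "0 = poly_diffop 0" "1 = poly_diffop 1"
  by (rule diffop_eqI; simp add: diffop_poly_simps map_poly_pCons const_op_def)+

lemma range_poly_diffop_mult:
  "A \<in> range poly_diffop \<Longrightarrow> B \<in> range poly_diffop \<Longrightarrow> A * B \<in> range poly_diffop"
  using poly_diffop_mult by (metis (no_types, lifting) imageE rangeI)

lemma range_poly_diffop_sum:
  "(\<And>i. i \<in> I \<Longrightarrow> f i \<in> range poly_diffop) \<Longrightarrow> (\<Sum>i\<in>I. f i) \<in> range poly_diffop"
  by (induction I rule: infinite_finite_induct)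
     (auto simp: poly_diffop_basic(4), metis poly_diffop_add image_iff rangeI)

lemma range_poly_diffop_power:
  "A \<in> range poly_diffop \<Longrightarrow> A ^ n \<in> range poly_diffop"
  by (induction n) (use poly_diffop_basic(5) range_poly_diffop_mult in auto)

lemma z_L_F_polynomial:
  obtains \<Lambda> where "z_op * L_F d = poly_diffop \<Lambda>"
proof -
  have 1: "z_op \<in> range poly_diffop" "D_op \<in> range poly_diffop" "const_op c \<in> range poly_diffop" for c
    using poly_diffop_basic by (metis rangeI)+
  then have "theta_op \<in> range poly_diffop"
    unfolding theta_op_def by (intro range_poly_diffop_mult)
  then have "poly_theta R \<in> range poly_diffop" for R
    unfolding poly_theta_def
    by (intro range_poly_diffop_sum range_poly_diffop_mult range_poly_diffop_power 1)
  then have "z_op * L_F d \<in> range poly_diffop"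
    unfolding z_op_L_F
    by (intro range_poly_diffop_sum range_poly_diffop_mult range_poly_diffop_power 1)
  then show ?thesis using that by auto
qed

lemma clear_denominators:
  obtains g \<alpha> where "g \<noteq> 0" "of_ratfun (to_fract g) * A = poly_diffop \<alpha>"
proof -
  have "\<exists>g \<alpha>. g \<noteq> 0 \<and> smult (to_fract g) P = map_poly to_fract \<alpha>" for P :: "ratfun poly"
  proof (induction P)
    case 0
    then show ?case by (intro exI[of _ 1] exI[of _ 0]) simp
  next
    case (pCons a P)
    then obtain g \<alpha> where g: "g \<noteq> 0" "smult (to_fract g) P = map_poly to_fract \<alpha>" by auto
    obtain b c where a: "a = Fraction_Field.Fract b c" "c \<noteq> 0" by (cases a)
    have "to_fract (g * c) * a = to_fract (g * b)"
      using a by (simp add: to_fract_def eq_fract)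
    moreover have "smult (to_fract (g * c)) P = map_poly to_fract (smult c \<alpha>)"
      by (simp add: map_to_fract_smult mult.commute flip: g(2))
    ultimately have "smult (to_fract (g * c)) (pCons a P) = map_poly to_fract (pCons (g * b) (smult c \<alpha>))"
      by (simp add: map_poly_pCons)
    moreover have "g * c \<noteq> 0" using g a by simp
    ultimately show ?case by blast
  qed
  then obtain g \<alpha> where "g \<noteq> 0" "smult (to_fract g) (diffop_poly A) = map_poly to_fract \<alpha>" by blast
  then show ?thesis
    by (intro that[of g \<alpha>] diffop_eqI) (simp_all add: times_diffop.rep_eq skew_times_def)
qed

text \<open>
  Differentiating coefficients does not raise the degree, so each \<open>D\<close> only shifts the leading term.
\<close>

lemma D_left_degree:
  assumes "q \<noteq> 0"
  shows "degree ((D_left ^^ i) q) = degree q + i \<and> lead_coeff ((D_left ^^ i) q) = lead_coeff q"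
proof (induction i)
  case (Suc i)
  let ?p = "(D_left ^^ i) q"
  have "?p \<noteq> 0" using Suc assms by (metis leading_coeff_0_iff)
  then have "degree (map_poly ratfun_deriv ?p) < degree (pCons 0 ?p)"
    using degree_map_deriv[of ?p] by simp
  then have "degree (D_left ?p) = Suc (degree ?p)" "lead_coeff (D_left ?p) = lead_coeff ?p"
    using \<open>?p \<noteq> 0\<close> unfolding D_left_def
    by (simp_all add: degree_add_eq_left lead_coeff_add_le coeff_eq_0)
  then show ?case using Suc by (metis add_Suc_right comp_apply funpow.simps(2))
qed simp

lemma diffop_order_mult:
  assumes "A \<noteq> 0" "B \<noteq> 0"
  shows "diffop_order (A * B) = diffop_order A + diffop_order B"
proof -
  let ?p = "diffop_poly A" and ?q = "diffop_poly B"
  let ?t = "\<lambda>i. smult (coeff ?p i) ((D_left ^^ i) ?q)"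
  have nz: "?p \<noteq> 0" "?q \<noteq> 0" using assms by (metis diffop_eqI zero_diffop.rep_eq)+
  have c: "coeff (?t i) (degree ?p + degree ?q) = (if i = degree ?p then lead_coeff ?p * lead_coeff ?q else 0)"
    if "i \<le> degree ?p" for i
    using D_left_degree[OF nz(2), of i] that by (auto simp: coeff_eq_0 add.commute)
  have "coeff (skew_times ?p ?q) (degree ?p + degree ?q) =
     (\<Sum>i\<le>degree ?p. if i = degree ?p then lead_coeff ?p * lead_coeff ?q else 0)"
    unfolding skew_times_def coeff_sum using c by (intro sum.cong) auto
  then have "coeff (skew_times ?p ?q) (degree ?p + degree ?q) \<noteq> 0" using nz by simp
  moreover have "degree (skew_times ?p ?q) \<le> degree ?p + degree ?q"
    unfolding skew_times_def using D_left_degree[OF nz(2)]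
    by (intro degree_sum_le order.trans[OF degree_smult_le]) auto
  ultimately have "degree (skew_times ?p ?q) = degree ?p + degree ?q"
    using le_degree by (intro antisym) blast+
  then show ?thesis by (simp add: diffop_order_def times_diffop.rep_eq)
qed

abbreviation fls_of_poly :: "complex poly \<Rightarrow> complex fls" where
  "fls_of_poly f \<equiv> fps_to_fls (fps_of_poly f)"

lemma ratfun_to_fls_to_fract: "ratfun_to_fls (to_fract f) = fls_of_poly f"
  unfolding to_fract_def by (subst ratfun_to_fls_Fract) simp_all

lemma diffop_apply_poly_diffop: "diffop_apply (poly_diffop \<alpha>) (fls_of_poly f) = fls_of_poly (act \<alpha> f)"
proof -
  have d: "(fls_deriv ^^ i) (fls_of_poly f) = fls_of_poly ((pderiv ^^ i) f)" for i
    by (induction i) (simp_all add: fls_deriv_fps_to_fls fps_of_poly_pderiv)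
  have "fls_of_poly (\<Sum>i\<in>I. g i) = (\<Sum>i\<in>I. fls_of_poly (g i))" for g and I :: "nat set"
    by (induction I rule: infinite_finite_induct) (simp_all add: fps_of_poly_add)
  then show ?thesis
    by (simp add: diffop_apply_def diffop_order_poly_diffop coeff_map_poly ratfun_to_fls_to_fract d
        act_def fps_of_poly_mult fls_times_fps_to_fls)
qed

lemma diffop_apply_one: "diffop_apply 1 f = f"
  by (simp add: diffop_apply_def diffop_order_def one_diffop.rep_eq)

lemma diffop_apply_of_ratfun: "diffop_apply (of_ratfun a) f = ratfun_to_fls a * f"
  using diffop_apply_of_ratfun_mult[of a 1 f] by (simp add: diffop_apply_one)

text \<open>
  A factorization in the ring of operators becomes a statement about polynomials only, by applying
  both sides to them inside the Laurent series.
\<close>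

lemma factorization_act:
  assumes "of_ratfun (to_fract h) * poly_diffop L = poly_diffop \<alpha> * poly_diffop \<beta>"
  shows "h * act L f = act \<alpha> (act \<beta> f)"
proof -
  have "fls_of_poly (h * act L f) = fls_of_poly (act \<alpha> (act \<beta> f))"
    using arg_cong[OF assms, of "\<lambda>A. diffop_apply A (fls_of_poly f)"]
    by (simp add: diffop_apply_of_ratfun diffop_apply_mult diffop_apply_poly_diffop
        ratfun_to_fls_to_fract fps_of_poly_mult fls_times_fps_to_fls)
  then show ?thesis by (simp add: fps_of_poly_eq_iff)
qed

lemma diffop_apply_z: "diffop_apply z_op f = fls_X * f"
  by (simp add: diffop_apply_of_ratfun ratfun_to_fls_to_fract fps_of_poly_pCons)

lemma diffop_apply_z_power: "diffop_apply (z_op ^ k) f = fls_X ^ k * f"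
  by (induction k) (simp_all add: diffop_apply_one diffop_apply_mult diffop_apply_z mult.assoc)

lemma diffop_apply_theta: "diffop_apply theta_op f = fls_X * fls_deriv f"
  unfolding theta_op_def diffop_apply_mult diffop_apply_z
  using diffop_apply_D_mult[of 1 f] by (simp add: diffop_apply_one)

lemma diffop_apply_const: "diffop_apply (const_op c) f = fls_const c * f"
  by (simp add: const_op_def diffop_apply_of_ratfun ratfun_to_fls_to_fract fps_of_poly_const)

lemma diffop_apply_poly_theta:
  "diffop_apply (poly_theta R) (fps_to_fls (Abs_fps a)) = fps_to_fls (Abs_fps (\<lambda>n. poly R (of_nat n) * a n))"
proof (induction R arbitrary: a)
  case 0
  then show ?case by (simp add: fps_eq_iff)
next
  case (pCons c R)
  have "fls_X * fls_deriv (fps_to_fls (Abs_fps a)) = fps_to_fls (Abs_fps (\<lambda>n. of_nat n * a n))"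
  proof -
    have "fps_X * fps_deriv (Abs_fps a) = Abs_fps (\<lambda>n. of_nat n * a n)"
      by (rule fps_ext) (simp add: )
    then show ?thesis
      by (metis fls_X_conv_shift_1 fls_deriv_fps_to_fls fls_times_fps_to_fls fps_X_to_fls)
  qed
  then have "diffop_apply (poly_theta (pCons c R)) (fps_to_fls (Abs_fps a)) =
      fps_to_fls (fps_const c * Abs_fps a + Abs_fps (\<lambda>n. poly R (of_nat n) * (of_nat n * a n)))"
    by (simp add: poly_theta_pCons diffop_apply_add diffop_apply_mult diffop_apply_theta
        diffop_apply_const pCons fls_times_fps_to_fls flip: fps_const_to_fls)
  also have "fps_const c * Abs_fps a + Abs_fps (\<lambda>n. poly R (of_nat n) * (of_nat n * a n)) =
      Abs_fps (\<lambda>n. poly (pCons c R) (of_nat n) * a n)"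
    by (rule fps_ext) (simp add: algebra_simps)
  finally show ?case .
qed


section \<open>Symmetry and leading terms of the polynomials in the Euler derivation\<close>

lemma coeff_euler_times_theta:
  "coeff (euler_times euler_theta Q) m = [:of_nat m, 1:] * coeff Q m"
proof -
  have "coeff (euler_times euler_theta Q) m
      = (\<Sum>k\<le>degree Q. if k = m then [:of_nat m, 1:] * coeff Q m else 0)"
    by (auto simp: euler_times_def coeff_sum pcompose_pCons intro!: sum.cong)
  then show ?thesis by (simp add: coeff_eq_0)
qed

lemma coeff_euler_times_t:
  "coeff (euler_times (smult [:c:] euler_t) Q) m
    = (case m of 0 \<Rightarrow> 0 | Suc m' \<Rightarrow> smult c (coeff Q m'))"
proof (cases "c = 0")
  case True
  then show ?thesis by (simp add: euler_times_def split: nat.split)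
next
  case False
  then have *: "degree (smult [:c:] euler_t) = 1" by simp
  have "coeff (euler_times (smult [:c:] euler_t) Q) m
      = (\<Sum>k\<le>degree Q. if Suc k = m then smult c (coeff Q k) else 0)"
    unfolding euler_times_def * 
    by (simp add: coeff_sum pcompose_pCons)
  also have "\<dots> = (case m of 0 \<Rightarrow> 0 | Suc m' \<Rightarrow> smult c (coeff Q m'))"
    by (cases m) (auto simp: coeff_eq_0)
  finally show ?thesis .
qed

text \<open>
  The factor \<open>n (d - n + 1)\<close> of the recurrence, as in the off-diagonal products of the
  Sylvester-Kac matrix.
\<close>

definition kac_coeff :: "nat \<Rightarrow> nat \<Rightarrow> complex" where
  "kac_coeff d j = of_nat j * (of_nat d - of_nat j + 1)"

lemma coeff_P_op_Suc_Suc: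
  "coeff (P_op d (Suc (Suc n))) m = [:of_nat m, 1:] * coeff (P_op d (Suc n)) m
    - (case m of 0 \<Rightarrow> 0 | Suc m' \<Rightarrow> smult (kac_coeff d (Suc n)) (coeff (P_op d n) m'))"
  unfolding P_op.simps coeff_diff coeff_euler_times_theta coeff_euler_times_t kac_coeff_def ..

text \<open>
  The values of the coefficients of \<open>P_op\<close>, with an offset \<open>i\<close> in the weights. The offset is what
  makes it possible to peel off a factor at the other end of the continuant.
\<close>

fun continuant :: "(nat \<Rightarrow> complex) \<Rightarrow> nat \<Rightarrow> nat \<Rightarrow> nat \<Rightarrow> complex \<Rightarrow> complex" where
  "continuant c i 0 m x = (if m = 0 then 1 else 0)"
| "continuant c i (Suc 0) m x = (if m = 0 then x else 0)"
| "continuant c i (Suc (Suc n)) m x = (x + of_nat m) * continuant c i (Suc n) m x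
     - (case m of 0 \<Rightarrow> 0 | Suc m' \<Rightarrow> c (i + Suc n) * continuant c i n m' x)"

lemma poly_P_op: "poly (coeff (P_op d n) m) x = continuant (kac_coeff d) 0 n m x"
proof (induction n arbitrary: m rule: induct_nat_012)
  case (ge2 n)
  show ?case
    unfolding coeff_P_op_Suc_Suc continuant.simps
    using ge2 by (cases m) (simp_all add: algebra_simps)
qed (auto simp: coeff_pCons split: nat.split)

text \<open>
  Expansion at the right end. Normal ordering turns \<open>R(\<theta>) t\<close> into \<open>t R(\<theta> + 1)\<close>, hence the argument
  \<open>x + 1\<close>.
\<close>

lemma continuant_right:
  "continuant c i (Suc (Suc n)) m x = x * continuant c (Suc i) (Suc n) m x
     - (case m of 0 \<Rightarrow> 0 | Suc m' \<Rightarrow> c (Suc i) * continuant c (Suc (Suc i)) n m' (x + 1))"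
proof (induction n arbitrary: m rule: induct_nat_012)
  case 0
  then show ?case by (auto split: nat.split)
next
  case 1
  then show ?case by (auto simp: algebra_simps split: nat.split)
next
  case (ge2 n)
  show ?case
    unfolding continuant.simps(3)[of c i "Suc (Suc n)"] ge2
    by (cases m; cases "m - 1") (auto simp: algebra_simps)
qed

text \<open>
  The anti-automorphism \<open>\<theta> \<mapsto> - \<theta>\<close>, \<open>t \<mapsto> t\<close> reverses products and sends \<open>t^m R(\<theta>)\<close> to
  \<open>t^m R(- \<theta> - m)\<close>. It exchanges the two expansions of a continuant, so palindromic weights make
  the continuant invariant up to sign.
\<close>

lemma continuant_reflect:
  assumes c: "\<And>j. 0 < j \<Longrightarrow> j < N \<Longrightarrow> c (N - j) = c j"
  shows "i + n \<le> N \<Longrightarrow> continuant c i n m (- x - of_nat m)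
    = (-1) ^ n * continuant c (N - n - i) n m x"
proof (induction n arbitrary: i m rule: induct_nat_012)
  case (ge2 n)
  let ?i = "N - Suc (Suc n) - i"
  have e: "N - Suc n - Suc i = ?i" "N - n - Suc (Suc i) = ?i" by auto
  have c': "c (?i + Suc n) = c (Suc i)"
  proof -
    have "?i + Suc n = N - Suc i" using ge2.prems by linarith
    then show ?thesis using c[of "Suc i"] ge2.prems by simp
  qed
  have 1: "continuant c (Suc i) (Suc n) m (- x - of_nat m) = (-1) ^ Suc n * continuant c ?i (Suc n) m x"
    using ge2.IH(2)[of "Suc i" m] ge2.prems unfolding e by simp
  have 2: "continuant c (Suc (Suc i)) n m' (- x - of_nat (Suc m') + 1) = (-1) ^ n * continuant c ?i n m' x"
    for m'
    using ge2.IH(1)[of "Suc (Suc i)" m'] ge2.prems unfolding e by simp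
  show ?case
    unfolding continuant_right[of c i n]
    using 1 2 c' by (cases m) (simp_all add: algebra_simps)
qed auto

lemma R_B_reflect:
  "poly (R_B d m) (- x - of_nat m) = (-1) ^ Suc d * poly (R_B d m) x"
  unfolding R_B_def poly_P_op
  using continuant_reflect[of "Suc d" "kac_coeff d" 0 "Suc d" m x]
  by (auto simp: kac_coeff_def of_nat_diff algebra_simps)

text \<open>
  The coefficients of \<open>t^m \<theta>^(n - 2 m)\<close>, the leading terms of \<open>P_op d n\<close>. They satisfy the recurrence of
  \<open>P_op\<close> with commuting variables and \<open>\<theta> = 1\<close>.
\<close>

fun top_symbol :: "nat \<Rightarrow> nat \<Rightarrow> complex poly" where
  "top_symbol d 0 = 1"
| "top_symbol d (Suc 0) = 1"
| "top_symbol d (Suc (Suc n)) = top_symbol d (Suc n) - pCons 0 (smult (kac_coeff d (Suc n)) (top_symbol d n))"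

lemma top_symbol_eq_0: "n < 2 * m \<Longrightarrow> coeff (top_symbol d n) m = 0"
  by (induction d n arbitrary: m rule: top_symbol.induct) (auto simp: coeff_pCons split: nat.split)

lemma coeff_P_op_top:
  "n \<le> j + 2 * m \<Longrightarrow>
    coeff (coeff (P_op d n) m) j = (if j + 2 * m = n then coeff (top_symbol d n) m else 0)"
proof (induction d n arbitrary: m j rule: top_symbol.induct)
  case (1 d)
  then show ?case by (cases m; cases j) auto
next
  case (2 d)
  then show ?case by (cases m; cases j) (auto simp: coeff_pCons split: nat.split)
next
  case (3 d n)
  show ?case
    unfolding coeff_P_op_Suc_Suc
    using 3 top_symbol_eq_0[of n m] top_symbol_eq_0[of "Suc n" m]
    by (cases m; cases j) auto
qed

text \<open>
  \<open>G = (1 + s x)^a (1 - s x)^b\<close> satisfies \<open>(1 - s\<^sup>2 x\<^sup>2) G' = (1 - s\<^sup>2 (a + b) x) G\<close> for the derivative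
  \<open>G'\<close>; this is the recurrence on coefficients.
\<close>

lemma coeff_linear_power_recurrence:
  fixes s :: complex and a b :: nat
  assumes "s * (of_nat a - of_nat b) = 1"
  defines "g \<equiv> \<lambda>n. coeff ([:1, s:] ^ a * [:1, - s:] ^ b) n"
  shows "of_nat (Suc (Suc n)) * g (Suc (Suc n))
    = g (Suc n) - s\<^sup>2 * (of_nat a + of_nat b - of_nat n) * g n"
  and "g 1 = g 0"
proof -
  let ?A = "[:1, s:]" and ?B = "[:1, - s:]"
  let ?G = "?A ^ a * ?B ^ b"
  have "pderiv (f ^ k) * f = smult (of_nat k) (pderiv f * f ^ k)" for f :: "complex poly" and k
  proof (cases k)
    case (Suc l)
    show ?thesis unfolding Suc pderiv_power_Suc by (simp add: mult_ac)
  qed simp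
  from this[of "[:1, _:]"] have d: "pderiv ([:1, t:] ^ k) * [:1, t:] = smult (of_nat k * t) ([:1, t:] ^ k)"
    for t :: complex and k :: nat
    by (simp add: pderiv_pCons del: mult_pCons_right)
  have "pderiv ?G * (?A * ?B)
      = (pderiv (?A ^ a) * ?A) * (?B ^ b * ?B) + (pderiv (?B ^ b) * ?B) * (?A ^ a * ?A)"
    unfolding pderiv_mult by (simp only: algebra_simps)
  also have "\<dots> = ?G * (smult (of_nat a * s) ?B - smult (of_nat b * s) ?A)"
  proof -
    have "smult x F * (G * B) + smult (- y) G * (F * A) = F * G * (smult x B - smult y A)"
      for x y and F G A B :: "complex poly"
      by (simp add: algebra_simps)
    then show ?thesis unfolding d mult_minus_right .
  qed
  also have "smult (of_nat a * s) ?B - smult (of_nat b * s) ?A = [:1, - (s\<^sup>2 * (of_nat a + of_nat b)):]"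
    using assms(1) by (simp add: algebra_simps power2_eq_square)
  also have "?A * ?B = [:1, 0, - s\<^sup>2:]" by (simp add: power2_eq_square)
  finally have *: "pderiv ?G * [:1, 0, - s\<^sup>2:] = ?G * [:1, - (s\<^sup>2 * (of_nat a + of_nat b)):]" .
  show "of_nat (Suc (Suc n)) * g (Suc (Suc n))
    = g (Suc n) - s\<^sup>2 * (of_nat a + of_nat b - of_nat n) * g n"
    using arg_cong[OF *, of "\<lambda>f. coeff f (Suc n)"]
    by (cases n) (simp_all add: g_def coeff_pderiv algebra_simps)
  show "g 1 = g 0"
    using arg_cong[OF *, of "\<lambda>f. coeff f 0"] by (simp add: g_def coeff_pderiv)
qed

text \<open>
  For \<open>s = 1 / (d - 2 j)\<close> the exponential generating function of the values of \<open>top_symbol d n\<close> at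
  \<open>s\<^sup>2\<close> is \<open>(1 + s x)^(d - j) (1 - s x)^j\<close>, a polynomial of degree \<open>d\<close>; its coefficient at \<open>d + 1\<close>
  vanishes.
\<close>

lemma top_symbol_root:
  assumes "2 * j < d"
  shows "poly (top_symbol d (Suc d)) (1 / (of_nat (d - 2 * j))\<^sup>2) = 0"
proof -
  define s :: complex where "s = 1 / of_nat (d - 2 * j)"
  define g where "g = coeff ([:1, s:] ^ (d - j) * [:1, - s:] ^ j)"
  have "of_nat (d - j) - (of_nat j :: complex) = of_nat (d - 2 * j)"
    using assms by (simp add: of_nat_diff)
  moreover have "of_nat (d - 2 * j) \<noteq> (0 :: complex)"
    using assms unfolding of_nat_eq_0_iff by simp
  ultimately have s: "s * (of_nat (d - j) - of_nat j) = 1"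
    unfolding s_def by (metis divide_self mult_1 times_divide_eq_left)
  have ab: "of_nat (d - j) + of_nat j = (of_nat d :: complex)"
    using assms by (simp add: of_nat_diff)
  note rec = coeff_linear_power_recurrence[OF s, folded g_def, unfolded ab]
  have "poly (top_symbol d n) (s\<^sup>2) = fact n * g n" for n
  proof (induction n rule: induct_nat_012)
    case (ge2 n)
    have "fact (Suc (Suc n)) * g (Suc (Suc n)) = fact (Suc n) * (of_nat (Suc (Suc n)) * g (Suc (Suc n)))"
      by (simp add: algebra_simps)
    also have "\<dots> = fact (Suc n) * g (Suc n)
        - s\<^sup>2 * (of_nat (Suc n) * (of_nat d - of_nat n)) * (fact n * g n)"
      unfolding rec(1) by (simp add: algebra_simps)
    also have "\<dots> = poly (top_symbol d (Suc (Suc n))) (s\<^sup>2)"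
      using ge2 by (simp add: kac_coeff_def algebra_simps)
    finally show ?case ..
  qed (use rec(2) in \<open>auto simp: g_def coeff_mult coeff_0_power\<close>)
  moreover have "degree ([:1, s:] ^ (d - j) * [:1, - s:] ^ j) \<le> (d - j) * 1 + j * 1"
    by (intro order.trans[OF degree_mult_le] add_mono order.trans[OF degree_power_le]) auto
  then have "g (Suc d) = 0" using assms unfolding g_def by (intro coeff_eq_0) auto
  ultimately show ?thesis by (simp add: s_def power_divide)
qed


text \<open>
  The degree is at most \<open>(d + 1) div 2\<close>, and this many distinct roots are known.
\<close>

lemma top_symbol_simple_roots:
  fixes d :: nat
  defines "q \<equiv> top_symbol d (Suc d)"
  shows "degree q = Suc d div 2" and "q \<noteq> 0"
    and "poly q p = 0 \<Longrightarrow> poly (pderiv q) p \<noteq> 0"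
proof -
  let ?r = "Suc d div 2"
  let ?t = "\<lambda>j. 1 / (of_nat (d - 2 * j))\<^sup>2 :: complex"
  have c0: "coeff (top_symbol d n) 0 = 1" for n
    by (induction n rule: induct_nat_012) auto
  then show q0: "q \<noteq> 0" unfolding q_def by (metis coeff_0 zero_neq_one)
  \<comment> \<open>For \<open>j < ?r\<close> the numbers \<open>d - 2 j\<close> are positive and distinct.\<close>
  have "inj_on ?t {..<?r}"
  proof (rule inj_onI)
    fix i j assume ij: "i \<in> {..<?r}" "j \<in> {..<?r}" "?t i = ?t j"
    then have "(of_nat ((d - 2 * i)\<^sup>2) :: complex) = of_nat ((d - 2 * j)\<^sup>2)"
      by (simp add: field_simps)
    then have "(d - 2 * i)\<^sup>2 = (d - 2 * j)\<^sup>2" by (simp only: of_nat_eq_iff)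
    then have "d - 2 * i = d - 2 * j" by simp
    then show "i = j" using ij(1,2) by auto
  qed
  then have "card (?t ` {..<?r}) = card {..<?r}" by (rule card_image)
  then have "card (?t ` {..<?r}) = ?r" unfolding card_lessThan .
  moreover have "?t ` {..<?r} \<subseteq> {x. poly q x = 0}"
    unfolding q_def using top_symbol_root[of _ d] by (intro image_subsetI) simp
  ultimately have card: "?r \<le> card {x. poly q x = 0}"
    using card_mono[OF poly_roots_finite[OF q0]] by metis
  moreover have "degree q \<le> ?r"
    unfolding q_def by (intro degree_le allI impI top_symbol_eq_0) auto
  ultimately show deg: "degree q = ?r" using card_poly_roots_bound[OF q0] by linarith
  show "poly (pderiv q) p \<noteq> 0" if qp: "poly q p = 0"
  proof
    assume d0: "poly (pderiv q) p = 0"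
    obtain g where g: "q = [:- p, 1:] * g" using qp unfolding poly_eq_0_iff_dvd by (rule dvdE)
    have g0: "g \<noteq> 0" using g q0 by auto
    have "poly (pderiv q) p = poly g p" unfolding g pderiv_mult by (simp add: pderiv_pCons)
    then have gp: "poly g p = 0" using d0 by simp
    have qg: "poly q x = (x - p) * poly g x" for x unfolding g by (simp add: algebra_simps)
    have "{x. poly q x = 0} \<subseteq> {x. poly g x = 0}" using gp by (auto simp: qg)
    then have "card {x. poly q x = 0} \<le> card {x. poly g x = 0}"
      by (intro card_mono poly_roots_finite g0)
    then have "?r \<le> degree g"
      using card card_poly_roots_bound[OF g0] by linarith
    moreover have "degree q = Suc (degree g)"
      unfolding g using g0 by (subst degree_mult_eq) simp_all
    ultimately show False using deg by simp
  qed
qed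

lemma coeff_shift_poly_top:
  "degree f \<le> Suc n \<Longrightarrow> coeff (pcompose f [:c, 1:]) (Suc n) = coeff f (Suc n) \<and>
    coeff (pcompose f [:c, 1:]) n = coeff f n + of_nat (Suc n) * c * coeff (f :: complex poly) (Suc n)"
proof (induction n arbitrary: f)
  case 0
  obtain a g where f: "f = pCons a g" by (cases f)
  then have "degree g = 0" using 0 by (auto split: if_splits)
  then obtain b where "g = [:b:]" by (rule degree_eq_zeroE)
  then show ?case using f by (simp add: pcompose_pCons)
next
  case (Suc n)
  obtain a g where f: "f = pCons a g" by (cases f)
  then have g: "degree g \<le> Suc n" using Suc.prems by (auto split: if_splits)
  have "coeff (pcompose g [:c, 1:]) (Suc (Suc n)) = 0" "coeff g (Suc (Suc n)) = 0"
    using g by (auto intro!: coeff_eq_0 simp: degree_pcompose)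
  then show ?case using Suc.IH[OF g] unfolding f by (simp add: pcompose_pCons algebra_simps)
qed

text \<open>
  In the variable \<open>x + c / 2\<close> the polynomial has the parity of \<open>n + 1\<close>, so its coefficient at \<open>n\<close>
  vanishes there; going back to \<open>x\<close> recreates it from the leading coefficient.
\<close>

lemma next_coeff_of_reflection:
  fixes p :: "complex poly"
  assumes deg: "degree p \<le> Suc n"
    and refl: "\<And>x. poly p (- x - c) = (-1) ^ Suc n * poly p x"
  shows "coeff p n = of_nat (Suc n) * c / 2 * coeff p (Suc n)"
proof -
  define s where "s = pcompose p [:- (c / 2), 1:]"
  have "pcompose s [:0, -1:] = smult ((-1) ^ Suc n) s"
  proof (rule poly_eqI_nat[of 0])
    fix y :: nat
    show "poly (pcompose s [:0, -1:]) (of_nat y) = poly (smult ((-1) ^ Suc n) s) (of_nat y)"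
      using refl[of "of_nat y - c / 2"] by (simp add: s_def poly_pcompose)
  qed
  then have "(-1) ^ n * coeff s n = (-1) ^ Suc n * coeff s n"
    by (metis coeff_pcompose_linear coeff_smult)
  then have "coeff s n = 0" by simp
  then show ?thesis using coeff_shift_poly_top[OF deg, of "- (c / 2)"] by (simp add: s_def)
qed

lemma prod_shifted_squares:
  fixes k :: nat
  defines "Q \<equiv> (\<Prod>j = 1..k. [:of_nat j, 1:] ^ 2 :: complex poly)"
  shows "degree Q = 2 * k" and "coeff Q (2 * k) = 1"
    and "poly Q (- x - of_nat (Suc k)) = poly Q x"
    and "proots Q = (\<Sum>j = 1..k. {#- of_nat j, - of_nat j#})"
proof -
  show deg: "degree Q = 2 * k"
    unfolding Q_def by (simp add: degree_prod_eq_sum_degree degree_power_eq)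
  have "lead_coeff Q = 1" by (simp add: Q_def lead_coeff_prod lead_coeff_power)
  then show "coeff Q (2 * k) = 1" by (simp add: deg)
  have "poly Q (- x - of_nat (Suc k)) = (\<Prod>j = 1..k. (of_nat j - x - of_nat (Suc k)) ^ 2)"
    by (simp add: Q_def poly_prod algebra_simps)
  also have "\<dots> = (\<Prod>j = 1..k. (of_nat (Suc k - j) - x - of_nat (Suc k)) ^ 2)"
    by (subst prod.atLeastAtMost_rev) simp
  also have "\<dots> = (\<Prod>j = 1..k. (of_nat j + x) ^ 2)"
    by (intro prod.cong) (auto simp: of_nat_diff power2_eq_square algebra_simps)
  finally show "poly Q (- x - of_nat (Suc k)) = poly Q x" by (simp add: Q_def poly_prod)
  show "proots Q = (\<Sum>j = 1..k. {#- of_nat j, - of_nat j#})"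
  proof -
    have "proots ([:a, 1:] ^ 2) = {#- a, - a#}" for a :: complex
      unfolding proots_power proots_linear_factor by (simp add: numeral_2_eq_2)
    moreover have "proots Q = (\<Sum>j = 1..k. proots ([:of_nat j, 1:] ^ 2))"
      unfolding Q_def by (rule proots_prod) simp
    ultimately show ?thesis by (simp only:)
  qed
qed

lemma R_poly_reflect:
  assumes "d \<ge> 1"
  shows "poly (R_poly d k) (- x - of_nat k) = (-1) ^ (d - 1) * poly (R_poly d k) x"
proof (cases k)
  case 0
  then show ?thesis by (simp add: R_poly_def poly_monom power_minus')
next
  case (Suc l)
  have "(-1) ^ Suc d = ((-1) ^ (d - 1) :: complex)"
    using assms by (cases d) auto
  then show ?thesis
    using R_B_reflect[of d k x] prod_shifted_squares(3)[of l x] by (simp add: R_poly_def Suc mult_ac)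
qed

lemma degree_mult_le_coeff:
  fixes f g :: "complex poly"
  assumes "degree f \<le> a" "degree g \<le> b"
  shows "degree (f * g) \<le> a + b" and "coeff (f * g) (a + b) = coeff f a * coeff g b"
proof -
  show *: "degree (f * g) \<le> a + b" using assms degree_mult_le[of f g] by linarith
  show "coeff (f * g) (a + b) = coeff f a * coeff g b"
  proof (cases "degree f = a \<and> degree g = b")
    case True
    then show ?thesis using coeff_mult_degree_sum[of f g] by simp
  next
    case False
    then have "degree (f * g) < a + b" using assms degree_mult_le[of f g] by linarith
    moreover have "coeff f a * coeff g b = 0"
      using False assms by (metis coeff_eq_0 le_neq_implies_less mult_eq_0_iff)
    ultimately show ?thesis by (simp add: coeff_eq_0)
  qed
qed

lemma R_B_top:
  assumes "2 * k \<le> Suc d"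
  shows "degree (R_B d k) \<le> Suc d - 2 * k"
    and "coeff (R_B d k) (Suc d - 2 * k) = coeff (top_symbol d (Suc d)) k"
proof -
  have *: "coeff (R_B d k) j = (if j + 2 * k = Suc d then coeff (top_symbol d (Suc d)) k else 0)"
    if "Suc d \<le> j + 2 * k" for j
    using coeff_P_op_top[OF that, of d] by (simp only: R_B_def Suc_eq_plus1)
  show "degree (R_B d k) \<le> Suc d - 2 * k"
    using * by (intro degree_le) auto
  show "coeff (R_B d k) (Suc d - 2 * k) = coeff (top_symbol d (Suc d)) k"
    using * assms by simp
qed

lemma R_poly_top:
  assumes d: "d \<ge> 2" and k: "2 * k \<le> Suc d"
  shows "degree (R_poly d k) \<le> d - 1"
    and "coeff (R_poly d k) (d - 1) = coeff (top_symbol d (Suc d)) k"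
    and "coeff (R_poly d k) (d - 2) = of_nat (d - 1) * of_nat k / 2 * coeff (top_symbol d (Suc d)) k"
proof -
  have "degree (R_poly d k) \<le> d - 1 \<and> coeff (R_poly d k) (d - 1) = coeff (top_symbol d (Suc d)) k"
  proof (cases k)
    case 0
    have "coeff (top_symbol d n) 0 = 1" for n
      by (induction n rule: induct_nat_012) auto
    then show ?thesis by (simp add: 0 R_poly_def degree_monom_eq)
  next
    case (Suc l)
    have *: "d - 1 = (Suc d - 2 * k) + 2 * l" using k Suc by simp
    show ?thesis
      unfolding * using degree_mult_le_coeff[OF R_B_top(1)[OF k], of _ "2 * l"] prod_shifted_squares[of l]
        R_B_top(2)[OF k]
      by (simp add: R_poly_def Suc)
  qed
  then show deg: "degree (R_poly d k) \<le> d - 1"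
    and top: "coeff (R_poly d k) (d - 1) = coeff (top_symbol d (Suc d)) k" by auto
  have e: "d - 1 = Suc (d - 2)" using d by simp
  show "coeff (R_poly d k) (d - 2) = of_nat (d - 1) * of_nat k / 2 * coeff (top_symbol d (Suc d)) k"
    using next_coeff_of_reflection[of "R_poly d k" "d - 2" "of_nat k"] deg top R_poly_reflect[of d k] d
    unfolding e by simp
qed

text \<open>
  The exponents of \<open>L_F d\<close> at infinity are \<open>1, 1, ..., r - 1, r - 1\<close>, and also \<open>r / 2\<close> for even \<open>d\<close>:
  then the linear polynomial \<open>R_B d r\<close> is odd under \<open>x \<mapsto> - x - r\<close> and vanishes at \<open>- r / 2\<close>.
\<close>

lemma sum_positive_parts_at_infinity:
  assumes d: "d \<ge> 3"
  defines "r \<equiv> (d + 1) div 2"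
  shows "(\<Sum>x\<in>#proots (R_poly d r). max 0 (\<tau> + Re x))
    = (\<Sum>j = 1..r - 1. 2 * max 0 (\<tau> - real j)) + (if even d then max 0 (\<tau> - real r / 2) else 0)"
    and "R_poly d r \<noteq> 0"
proof -
  let ?q = "top_symbol d (Suc d)"
  let ?Q = "\<Prod>j = 1..r - 1. [:of_nat j, 1:] ^ 2 :: complex poly"
  have r: "2 * r \<le> Suc d" "r \<ge> 2" "Suc d - 2 * r = (if even d then 1 else 0)"
    using d by (auto simp: r_def elim!: evenE oddE)
  have R: "R_poly d r = R_B d r * ?Q" using r by (simp add: R_poly_def)
  have "coeff ?q r \<noteq> 0"
    using top_symbol_simple_roots(1,2)[of d] by (metis Suc_eq_plus1 leading_coeff_0_iff r_def)
  then have top: "coeff (R_B d r) (Suc d - 2 * r) \<noteq> 0" using R_B_top(2)[OF r(1)] by simp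
  then have RB0: "R_B d r \<noteq> 0" by auto
  have Q0: "?Q \<noteq> 0" by (simp add: prod_zero_iff)
  show "R_poly d r \<noteq> 0" using R RB0 Q0 by simp
  have dist: "(\<Sum>x\<in>#(\<Sum>j\<in>I. M j). f x) = (\<Sum>j\<in>I. \<Sum>x\<in>#M j. f x)"
    for f :: "complex \<Rightarrow> real" and M and I :: "nat set"
    by (induction I rule: infinite_finite_induct) auto
  have 1: "(\<Sum>x\<in>#proots ?Q. max 0 (\<tau> + Re x)) = (\<Sum>j = 1..r - 1. 2 * max 0 (\<tau> - real j))"
    unfolding prod_shifted_squares(4) dist by (intro sum.cong) auto
  have "proots (R_B d r) = (if even d then {#- (of_nat r / 2)#} else {#})"
  proof (cases "even d")
    case True
    have "degree (R_B d r) = 1"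
      using R_B_top(1)[OF r(1)] top r(3) True le_degree[of "R_B d r" 1] by simp
    then have "size (proots (R_B d r)) = 1" by (simp add: size_proots_complex)
    then obtain a where a: "proots (R_B d r) = {#a#}" using size_1_singleton_mset by blast
    have "poly (R_B d r) (- (of_nat r / 2)) = 0"
      using R_B_reflect[of d r "- (of_nat r / 2)"] True by (simp add: field_simps)
    then have "- (of_nat r / 2) \<in># proots (R_B d r)" using RB0 by simp
    then show ?thesis using a True by simp
  next
    case False
    have "degree (R_B d r) = 0" using R_B_top(1)[OF r(1)] r(3) False by simp
    then have "size (proots (R_B d r)) = 0" by (simp add: size_proots_complex)
    then show ?thesis using False by simp
  qed
  then have 2: "(\<Sum>x\<in>#proots (R_B d r). max 0 (\<tau> + Re x)) = (if even d then max 0 (\<tau> - real r / 2) else 0)"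
    by auto
  show "(\<Sum>x\<in>#proots (R_poly d r). max 0 (\<tau> + Re x))
    = (\<Sum>j = 1..r - 1. 2 * max 0 (\<tau> - real j)) + (if even d then max 0 (\<tau> - real r / 2) else 0)"
    unfolding R using 1 2 RB0 Q0 by (simp add: proots_mult)
qed


section \<open>The generating function as a power of a Bessel series\<close>

lemma diffop_apply_euler_sum:
  "diffop_apply (\<Sum>k\<le>r. z_op ^ k * poly_theta (S k)) (fps_to_fls (Abs_fps a)) =
    fps_to_fls (Abs_fps (\<lambda>n. \<Sum>k\<le>r. if k \<le> n then poly (S k) (of_nat (n - k)) * a (n - k) else 0))"
proof -
  have "diffop_apply (z_op ^ k * poly_theta (S k)) (fps_to_fls (Abs_fps a)) =
      fps_to_fls (fps_X ^ k * Abs_fps (\<lambda>n. poly (S k) (of_nat n) * a n))" for k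
    by (simp add: diffop_apply_mult diffop_apply_poly_theta diffop_apply_z_power
        fls_times_fps_to_fls fps_to_fls_power)
  moreover have "fps_to_fls (\<Sum>k\<in>I. f k) = (\<Sum>k\<in>I. fps_to_fls (f k :: complex fps))"
    for f and I :: "nat set"
    by (induction I rule: infinite_finite_induct) simp_all
  ultimately have "diffop_apply (\<Sum>k\<le>r. z_op ^ k * poly_theta (S k)) (fps_to_fls (Abs_fps a)) =
      fps_to_fls (\<Sum>k\<le>r. fps_X ^ k * Abs_fps (\<lambda>n. poly (S k) (of_nat n) * a n))"
    by (simp add: diffop_apply_sum)
  also have "(\<Sum>k\<le>r. fps_X ^ k * Abs_fps (\<lambda>n. poly (S k) (of_nat n) * a n)) =
      Abs_fps (\<lambda>n. \<Sum>k\<le>r. if k \<le> n then poly (S k) (of_nat (n - k)) * a (n - k) else 0)"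
    by (rule fps_ext) (auto simp: fps_sum_nth fps_X_power_mult_nth intro!: sum.cong)
  finally show ?thesis .
qed

text \<open>
  The Euler form of the operator lists its weight parts.
\<close>

lemma indicial_z_L_F:
  assumes "z_op * L_F d = poly_diffop \<Lambda>"
  shows "indicial \<Lambda> w = (if 0 \<le> w \<and> w \<le> int ((d + 1) div 2) then R_poly d (nat w) else 0)"
proof (rule poly_eqI_nat[where N = "nat \<bar>w\<bar>"])
  let ?r = "(d + 1) div 2"
  fix s assume "s \<ge> nat \<bar>w\<bar>"
  define m where "m = nat (int s + w)"
  have w: "w = int m - int s" using \<open>s \<ge> nat \<bar>w\<bar>\<close> by (simp add: m_def)
  have "fps_of_poly (monom 1 s) = Abs_fps (\<lambda>n. if n = s then 1 else 0 :: complex)"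
    by (rule fps_ext) simp
  then have "fls_of_poly (act \<Lambda> (monom 1 s)) = fps_to_fls (Abs_fps (\<lambda>n. \<Sum>k\<le>?r.
      if k \<le> n then poly (R_poly d k) (of_nat (n - k)) * (if n - k = s then 1 else 0) else 0))"
    by (simp only: diffop_apply_poly_diffop[symmetric] assms[symmetric] z_op_L_F diffop_apply_euler_sum)
  then have "fps_of_poly (act \<Lambda> (monom 1 s)) = Abs_fps (\<lambda>n. \<Sum>k\<le>?r.
      if k \<le> n then poly (R_poly d k) (of_nat (n - k)) * (if n - k = s then 1 else 0) else 0)"
    by (simp only: fps_to_fls_eq_iff)
  then have "coeff (act \<Lambda> (monom 1 s)) m = (\<Sum>k\<le>?r.
      if k \<le> m then poly (R_poly d k) (of_nat (m - k)) * (if m - k = s then 1 else 0) else 0)"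
    by (metis (no_types, lifting) fps_nth_Abs_fps fps_of_poly_nth)
  also have "\<dots> = (\<Sum>k\<le>?r. if k = m - s then (if s \<le> m then poly (R_poly d (m - s)) (of_nat s) else 0) else 0)"
    by (intro sum.cong) auto
  also have "\<dots> = poly (if 0 \<le> w \<and> w \<le> int ?r then R_poly d (nat w) else 0) (of_nat s)"
    by (auto simp: w nat_diff_distrib)
  finally show "poly (indicial \<Lambda> w) (of_nat s) = \<dots>"
    by (simp only: coeff_act_monom w)
qed

definition bessel_series :: "complex fps" where
  "bessel_series = Abs_fps (\<lambda>n. 1 / (fact n)\<^sup>2)"

definition euler_deriv :: "complex fls \<Rightarrow> complex fls" where
  "euler_deriv f = fls_X * fls_deriv f"

lemma euler_deriv_mult: "euler_deriv (f * g) = euler_deriv f * g + f * euler_deriv g"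
  by (simp add: euler_deriv_def algebra_simps)

lemma euler_deriv_power: "euler_deriv (f ^ k) = of_nat k * f ^ (k - 1) * euler_deriv f"
proof (induction k)
  case (Suc k)
  then show ?case by (cases k) (simp_all add: euler_deriv_mult algebra_simps)
qed (simp add: euler_deriv_def)

lemma euler_deriv_of_nat: "euler_deriv (of_nat c * f) = of_nat c * euler_deriv f"
  by (simp add: euler_deriv_def fls_of_nat algebra_simps)

lemma bessel_equation:
  "euler_deriv (euler_deriv (fps_to_fls bessel_series)) = fls_X * fps_to_fls bessel_series"
proof -
  have e: "euler_deriv (fps_to_fls f) = fps_to_fls (fps_X * fps_deriv f)" for f
    by (simp add: euler_deriv_def fls_deriv_fps_to_fls fls_times_fps_to_fls)
  have "fps_X * fps_deriv (fps_X * fps_deriv bessel_series) = fps_X * bessel_series"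
  proof (rule fps_ext)
    fix n
    have "of_nat (Suc j) * (of_nat (Suc j) / (fact (Suc j))\<^sup>2) = 1 / (fact j :: complex)\<^sup>2" for j
      unfolding fact_Suc power_mult_distrib by (simp add: power2_eq_square del: of_nat_Suc)
    moreover have "(fps_X * fps_deriv f) $ n = of_nat n * f $ n" for f :: "complex fps"
      by (cases n) simp_all
    ultimately show "(fps_X * fps_deriv (fps_X * fps_deriv bessel_series)) $ n = (fps_X * bessel_series) $ n"
      by (cases n) (simp_all add: bessel_series_def del: of_nat_Suc fact_Suc fps_deriv_mult)
  qed
  then show ?thesis unfolding e by (simp add: fls_times_fps_to_fls)
qed

text \<open>
  \<open>P_op\<close> computes the derivatives of \<open>y^d\<close> for a solution of \<open>\<theta>\<^sup>2 y = z y\<close>: applying \<open>\<theta>\<close> to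
  \<open>y^(d - n) (\<theta> y)^n\<close> gives the next such product and a multiple of the previous one, which the
  recurrence subtracts. At \<open>n = d + 1\<close> the falling factorial in front is \<open>0\<close>.
\<close>

lemma diffop_apply_P_op:
  assumes "n \<le> Suc d"
  shows "diffop_apply (euler_to_diffop (P_op d n)) (fps_to_fls bessel_series ^ d) =
    of_nat (\<Prod>i<n. d - i) * fps_to_fls bessel_series ^ (d - n)
      * euler_deriv (fps_to_fls bessel_series) ^ n"
  using assms
proof (induction n rule: induct_nat_012)
  case 0
  then show ?case by (simp add: euler_to_diffop_1 diffop_apply_one)
next
  case 1
  then show ?case
    by (simp add: euler_to_diffop_theta diffop_apply_theta euler_deriv_power flip: euler_deriv_def)
next
  case (ge2 n)
  let ?Y = "fps_to_fls bessel_series" and ?c = "kac_coeff d (Suc n)"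
  let ?T = "euler_deriv ?Y"
  obtain e where d: "d = Suc n + e" using ge2.prems le_Suc_ex[of "Suc n" d] by auto
  define c where "c = (\<Prod>i<n. d - i)"
  have c1: "(\<Prod>i<Suc n. d - i) = c * Suc e" "(\<Prod>i<Suc (Suc n). d - i) = c * Suc e * e"
    by (simp_all add: c_def d Suc_diff_le)
  have k: "?c = of_nat (Suc n * Suc e)" by (simp add: kac_coeff_def d algebra_simps)
  have "smult [:?c:] euler_t = monom [:?c:] 1" by (simp add: monom_altdef)
  then have t: "euler_to_diffop (smult [:?c:] euler_t) = z_op * const_op ?c"
    by (simp add: euler_to_diffop_monom)
  have minus: "euler_to_diffop (p - q) = euler_to_diffop p - euler_to_diffop q" for p q
    using euler_to_diffop_add[of "p - q" q] by (simp add: algebra_simps)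
  have minus': "diffop_apply (A - B) f = diffop_apply A f - diffop_apply B f" for A B f
    using diffop_apply_add[of "A - B" B f] by (simp add: algebra_simps)
  have "diffop_apply (euler_to_diffop (P_op d (Suc (Suc n)))) (?Y ^ d) =
      euler_deriv (diffop_apply (euler_to_diffop (P_op d (Suc n))) (?Y ^ d))
      - fls_X * (of_nat (Suc n * Suc e) * diffop_apply (euler_to_diffop (P_op d n)) (?Y ^ d))"
    unfolding P_op.simps minus minus' euler_to_diffop_times euler_to_diffop_theta diffop_apply_mult
      diffop_apply_theta kac_coeff_def[symmetric] t[unfolded k] diffop_apply_z diffop_apply_const k
      euler_deriv_def fls_of_nat ..
  also have "diffop_apply (euler_to_diffop (P_op d n)) (?Y ^ d) = of_nat c * ?Y ^ Suc e * ?T ^ n"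
    using ge2.IH(1) ge2.prems by (simp add: c_def d)
  also have "diffop_apply (euler_to_diffop (P_op d (Suc n))) (?Y ^ d)
      = of_nat (c * Suc e) * (?Y ^ e * ?T ^ Suc n)"
    using ge2.IH(2) ge2.prems unfolding c1 by (simp add: d mult_ac)
  also have "euler_deriv \<dots> = of_nat (c * Suc e) * (of_nat e * ?Y ^ (e - 1) * ?T ^ Suc (Suc n)
      + of_nat (Suc n) * fls_X * ?Y ^ Suc e * ?T ^ n)"
  proof -
    have "euler_deriv (?Y ^ e * ?T ^ Suc n) = of_nat e * ?Y ^ (e - 1) * ?T ^ Suc (Suc n)
        + of_nat (Suc n) * fls_X * ?Y ^ Suc e * ?T ^ n"
      unfolding euler_deriv_mult euler_deriv_power bessel_equation by (simp add: mult_ac)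
    then show ?thesis by (simp only: euler_deriv_of_nat)
  qed
  finally show ?case
    unfolding c1 by (simp add: d algebra_simps)
qed

lemma bessel_power_nth:
  assumes "d \<ge> 1"
  shows "bessel_series ^ d $ n = x_seq d n / (fact n)\<^sup>2"
proof -
  obtain k where k: "d = Suc k" using assms by (cases d) auto
  have "bessel_series ^ d $ n = (\<Sum>v\<in>natpermute n d. \<Prod>j\<in>{0..k}. bessel_series $ (v ! j))"
    unfolding k fps_power_nth_Suc by simp
  also have "\<dots> = (\<Sum>v\<in>natpermute n d. 1 / (\<Prod>i<d. fact (v ! i))\<^sup>2)"
  proof -
    have "{0..k} = {..<d}" by (auto simp: k)
    then show ?thesis
      by (intro sum.cong refl) (simp add: bessel_series_def prod_dividef prod_power_distrib)
  qed
  also have "\<dots> = x_seq d n / (fact n)\<^sup>2"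
    by (simp add: x_seq_def natpermute_def sum_divide_distrib)
  finally show ?thesis .
qed

lemma R_B_0: "R_B d 0 = monom 1 (d + 1)"
proof -
  have "coeff (P_op d n) 0 = monom 1 n" for n
  proof (induction n rule: induct_nat_012)
    case (ge2 n)
    show ?case unfolding coeff_P_op_Suc_Suc ge2 by (simp add: monom_Suc)
  qed (simp_all add: monom_Suc)
  then show ?thesis by (simp only: R_B_def)
qed

lemma fact_times_shifted_prod:
  "fact m * (\<Prod>j = 1..l. of_nat m + of_nat j) = (fact (m + l) :: complex)"
proof (induction l)
  case (Suc l)
  have "fact m * (\<Prod>j = 1..Suc l. of_nat m + of_nat j)
      = (fact m * (\<Prod>j = 1..l. of_nat m + of_nat j)) * (of_nat (Suc (m + l)) :: complex)"
    by (simp add: algebra_simps)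
  also have "\<dots> = fact (m + Suc l)" unfolding Suc by simp
  finally show ?case .
qed simp

text \<open>
  With \<open>b n = x_seq d n / (n!)\<^sup>2\<close> the recurrence from \<open>P_op d (d + 1)\<close> is multiplied by
  \<open>((n - 1)!)\<^sup>2\<close>. The factor \<open>(j + n - k)\<^sup>2\<close>, \<open>1 \<le> j < k\<close>, of \<open>R_poly d k\<close> at \<open>n - k\<close> completes
  \<open>((n - k)!)\<^sup>2\<close> to \<open>((n - 1)!)\<^sup>2\<close>, and for \<open>k = 0\<close> the missing \<open>n\<^sup>2\<close> is the one by which
  \<open>R_B d 0\<close> exceeds \<open>R_poly d 0\<close>.
\<close>

lemma L_F_annihilates_F:
  assumes "d \<ge> 3"
  shows "diffop_apply (L_F d) (fps_to_fls (F_series d)) = 0"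
proof -
  let ?r = "(d + 1) div 2"
  define b where "b n = x_seq d n / (fact n)\<^sup>2" for n
  have x: "x_seq d n = b n * (fact n)\<^sup>2" for n by (simp add: b_def)
  have "fps_to_fls bessel_series ^ d = fps_to_fls (Abs_fps b)"
    using bessel_power_nth[of d] assms by (simp add: b_def fps_eq_iff flip: fps_to_fls_power)
  moreover have "diffop_apply (euler_to_diffop (P_op d (d + 1))) (fps_to_fls bessel_series ^ d) = 0"
    using diffop_apply_P_op[of "Suc d" d] by (simp add: prod_zero_iff)
  ultimately have "fps_to_fls (Abs_fps (\<lambda>n. \<Sum>k\<le>?r.
      if k \<le> n then poly (R_B d k) (of_nat (n - k)) * b (n - k) else 0)) = 0"
    unfolding euler_to_diffop_bound[OF degree_P_op] R_B_def[symmetric] diffop_apply_euler_sum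
    by (simp only: diffop_apply_euler_sum)
  then have rec: "(\<Sum>k\<le>?r. if k \<le> n then poly (R_B d k) (of_nat (n - k)) * b (n - k) else 0) = 0" for n
    by (simp add: fps_eq_iff)
  have "(\<Sum>k\<le>?r. if k \<le> n then poly (R_poly d k) (of_nat (n - k)) * x_seq d (n - k) else 0) = 0" for n
  proof (cases n)
    case 0
    have "(if k \<le> n then poly (R_poly d k) (of_nat (n - k)) * x_seq d (n - k) else 0) = 0" for k
      using assms by (auto simp: 0 R_poly_def poly_monom)
    then show ?thesis by simp
  next
    case (Suc m)
    have "(if k \<le> n then poly (R_poly d k) (of_nat (n - k)) * x_seq d (n - k) else 0) =
      (fact m)\<^sup>2 * (if k \<le> n then poly (R_B d k) (of_nat (n - k)) * b (n - k) else 0)" for k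
    proof (cases k)
      case 0
      have "(of_nat n :: complex) ^ (d + 1) = of_nat n ^ (d - 1) * (of_nat n)\<^sup>2"
        using assms by (simp flip: power_add)
      then show ?thesis by (simp add: 0 R_B_0 R_poly_def poly_monom x Suc power_mult_distrib)
    next
      case k: (Suc l)
      show ?thesis
      proof (cases "k \<le> n")
        case True
        have e: "(n - k) + l = m" using True Suc k by simp
        have "poly (\<Prod>j = 1..l. [:of_nat j, 1:] ^ 2) (of_nat (n - k)) * (fact (n - k))\<^sup>2
            = (fact (n - k) * (\<Prod>j = 1..l. of_nat (n - k) + of_nat j :: complex))\<^sup>2"
          by (simp add: poly_prod power_mult_distrib prod_power_distrib add.commute mult.commute)
        also have "\<dots> = (fact m :: complex)\<^sup>2"
          unfolding fact_times_shifted_prod e ..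
        finally show ?thesis using True by (simp add: k R_poly_def x mult_ac)
      qed simp
    qed
    then show ?thesis using rec[of n] by (simp only: sum_distrib_left[symmetric] mult_zero_right)
  qed
  then have "diffop_apply (z_op * L_F d) (fps_to_fls (F_series d)) = 0"
    unfolding z_op_L_F F_series_def diffop_apply_euler_sum by (simp add: fps_eq_iff)
  then show ?thesis by (simp add: diffop_apply_mult diffop_apply_z)
qed


section \<open>Irreducibility\<close>

lemma sum_subset_upper_bound:
  fixes \<tau> :: real
  assumes "A \<subseteq># B"
  shows "Re (sum_mset A) \<le> (\<Sum>x\<in>#B. max 0 (\<tau> + Re x)) - of_nat (size A) * \<tau>"
proof -
  have "Re (sum_mset (image_mset uminus A)) = - Re (sum_mset A)" by (induction A) auto
  then show ?thesis
    using sum_subset_lower_bound[OF image_mset_subseteq_mono[OF assms, of uminus], of \<tau>]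
    by (simp add: multiset.map_comp comp_def)
qed

text \<open>
  Let \<open>K = k + 1\<close> be the order of the factor and \<open>n = d - 1\<close>, so \<open>1 \<le> K < n\<close>. If \<open>K \<le> n / 2\<close>, the
  upper bound for the sum of the \<open>K\<close> exponents at infinity is \<open>0\<close>, although each of them is at least
  \<open>1\<close>: threshold \<open>\<tau> = 1\<close>. Otherwise the threshold \<open>\<tau> = r - 1\<close> leaves a gap of exactly \<open>n - K > 0\<close>
  between the lower and the upper bound.
\<close>

lemma exponent_sum_contradiction:
  assumes d: "d \<ge> 3" and r: "r = (d + 1) div 2"
    and A: "A \<subseteq># proots (R_poly d r)" "size A = Suc k" and k: "k < d - 2"
    and le: "- (real r * max 0 (real k - (real (d - 2) - 1) / 2)) \<le> Re (sum_mset A)"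
  shows False
proof -
  note up = sum_subset_upper_bound[OF A(1), unfolded A(2) r sum_positive_parts_at_infinity(1)[OF d],
      folded r]
  have r2: "r \<ge> 2" using d r by simp
  show False
  proof (cases "real k \<le> (real (d - 2) - 1) / 2")
    case True
    have "(\<Sum>j = 1..r - 1. 2 * max 0 (1 - real j)) = 0" by (intro sum.neutral) auto
    then show False using up[of 1] le True r2 by (auto split: if_splits)
  next
    case False
    have "(\<Sum>j = 1..m. 2 * max 0 (real m - real j)) = real m * (real m - 1)" for m
    proof -
      have "(\<Sum>j = 1..m. 2 * max 0 (real m - real j)) = (\<Sum>j = 1..m. 2 * (real m - real j))"
        by (intro sum.cong) auto
      also have "\<dots> = real m * (real m - 1)"
      proof -
        have *: "(\<Sum>j = 1..l. 2 * (c - real j)) = 2 * real l * c - real l * (real l + 1)" for l c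
          by (induction l) (simp_all add: field_simps)
        show ?thesis unfolding *[of "real m" m] by (simp add: algebra_simps)
      qed
      finally show ?thesis .
    qed
    note up' = up[of "real (r - 1)", unfolded this]
    have real: "real (r - 1) = real r - 1" "real (d - 2) = real d - 2" using r2 d by auto
    have kd: "real k + 2 < real d" using k by linarith
    show False
    proof (cases "even d")
      case True
      then have dr: "real d = 2 * real r" using r by (auto elim!: evenE)
      show False using up' le False True kd r2 unfolding real dr
        by (simp add: algebra_simps max_def split: if_splits)
    next
      case odd: False
      then have dr: "real d = 2 * real r - 1" using r by (auto elim!: oddE)
      show False using up' le False odd kd r2 unfolding real dr
        by (simp add: algebra_simps max_def split: if_splits)
    qed
  qed
qed

text \<open>
  The weight parts \<open>R_poly d k\<close> have leading coefficients \<open>a\<^sub>k\<close> and, by reflection, next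
  coefficients \<open>a\<^sub>k k n / 2\<close> with \<open>n = d - 1\<close>. Rewriting powers of \<open>\<theta>\<close> in terms of \<open>D\<close> gives the two
  leading coefficients in \<open>D\<close>; the factor \<open>k\<close> becomes \<open>z\<close> times the derivative of \<open>q\<close>.
\<close>

lemma z_L_F_shape:
  assumes d: "d \<ge> 3" and \<Lambda>: "z_op * L_F d = poly_diffop \<Lambda>"
  defines "m \<equiv> d - 2" and "q \<equiv> top_symbol d (Suc d)"
  shows "degree \<Lambda> = Suc m"
    and "coeff \<Lambda> (Suc m) = monom 1 (Suc m) * q"
    and "coeff \<Lambda> m = monom 1 m * (smult (of_nat m * of_nat (Suc m) / 2) q
      + smult (of_nat (Suc m) / 2) ([:0, 1:] * pderiv q))"
proof -
  let ?r = "(d + 1) div 2"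
  have m: "d - 1 = Suc m" "d - 2 = m" using d by (simp_all add: m_def)
  have top: "degree (R_poly d k) \<le> Suc m" "coeff (R_poly d k) (Suc m) = coeff q k"
      "coeff (R_poly d k) m = of_nat (Suc m) * of_nat k / 2 * coeff q k" if "k \<le> ?r" for k
    using R_poly_top[of d k] that d unfolding m q_def by auto
  have q_high: "coeff q k = 0" if "k > ?r" for k
    using that top_symbol_eq_0[of "Suc d" k d] by (simp add: q_def)
  note ind = indicial_z_L_F[OF \<Lambda>]
  have natd: "nat (int j - int i) = j - i" and neg: "int j - int i < 0 \<longleftrightarrow> j < i" for i j
    by linarith+
  have coeff_eq_int_coeff: "coeff f j = int_coeff f (int i + (int j - int i))" for f i j
    by (simp add: int_coeff_def)
  have "coeff (indicial \<Lambda> 0) (Suc m) = 1"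
    unfolding ind using m(1) by (simp add: R_poly_def)
  then have "Suc m \<le> degree (indicial \<Lambda> 0)" by (intro le_degree) simp
  then have ge: "Suc m \<le> degree \<Lambda>" using degree_indicial order.trans by blast
  have "degree \<Lambda> \<le> Suc m"
  proof (rule ccontr)
    assume gt: "\<not> ?thesis"
    let ?N = "degree \<Lambda>"
    have "coeff (coeff \<Lambda> ?N) j = 0" for j
    proof -
      have "degree (indicial \<Lambda> w) \<le> Suc m" for w
        unfolding ind using top(1)[of "nat w"] by auto
      then have "coeff (indicial \<Lambda> (int j - int ?N)) ?N = 0"
        using gt by (meson coeff_eq_0 le_less_trans not_le)
      then show ?thesis unfolding coeff_indicial_top by (simp add: int_coeff_def)
    qed
    then have "coeff \<Lambda> ?N = 0" by (simp add: poly_eq_iff)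
    then show False using gt by simp
  qed
  with ge show deg: "degree \<Lambda> = Suc m" by simp
  have lead: "int_coeff (coeff \<Lambda> (Suc m)) (int (Suc m) + w) = (if w < 0 then 0 else coeff q (nat w))" for w
    using coeff_indicial_top[of \<Lambda> w, unfolded deg] top(2)[of "nat w"] q_high[of "nat w"]
    by (auto simp: ind not_le split: if_splits)
  show leadm: "coeff \<Lambda> (Suc m) = monom 1 (Suc m) * q"
  proof (rule poly_eqI)
    fix j
    have "coeff (coeff \<Lambda> (Suc m)) j = (if j < Suc m then 0 else coeff q (j - Suc m))"
      unfolding coeff_eq_int_coeff[of _ j "Suc m"] lead natd neg ..
    then show "coeff (coeff \<Lambda> (Suc m)) j = coeff (monom 1 (Suc m) * q) j"
      by (simp add: coeff_monom_mult)
  qed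
  have next': "int_coeff (coeff \<Lambda> m) (int m + w) = (if w < 0 then 0 else
      (of_nat (Suc m) * of_nat (nat w) / 2 + of_nat m * of_nat (Suc m) / 2) * coeff q (nat w))" for w
  proof -
    have "coeff (indicial \<Lambda> w) m
        = (if w < 0 then 0 else of_nat (Suc m) * of_nat (nat w) / 2 * coeff q (nat w))"
    proof (cases "0 \<le> w \<and> w \<le> int ?r")
      case True
      then have "nat w \<le> ?r" by linarith
      then show ?thesis using top(3)[of "nat w"] True unfolding ind by simp
    next
      case False
      then have "w < 0 \<or> nat w > ?r" by linarith
      then show ?thesis using False q_high[of "nat w"] unfolding ind by auto
    qed
    from coeff_indicial_next[OF deg, of w, unfolded lead this] show ?thesis
      by (cases "w < 0") (simp_all add: distrib_right eq_diff_eq)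
  qed
  have x_deriv: "coeff ([:0, 1:] * pderiv q) i = of_nat i * coeff q i" for i
    by (cases i) (simp_all add: coeff_pderiv)
  show "coeff \<Lambda> m = monom 1 m * (smult (of_nat m * of_nat (Suc m) / 2) q
      + smult (of_nat (Suc m) / 2) ([:0, 1:] * pderiv q))"
  proof (rule poly_eqI)
    fix j
    have "coeff (coeff \<Lambda> m) j = (if j < m then 0 else
      (of_nat (Suc m) * of_nat (j - m) / 2 + of_nat m * of_nat (Suc m) / 2) * coeff q (j - m))"
      unfolding coeff_eq_int_coeff[of _ j m] next' natd neg ..
    also have "\<dots> = coeff (monom 1 m * (smult (of_nat m * of_nat (Suc m) / 2) q
      + smult (of_nat (Suc m) / 2) ([:0, 1:] * pderiv q))) j"
      unfolding coeff_monom_mult coeff_add coeff_smult x_deriv by (simp add: algebra_simps)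
    finally show "coeff (coeff \<Lambda> m) j = \<dots>" .
  qed
qed

lemma diffop_order_of_ratfun_mult: "diffop_order (of_ratfun a * A) = diffop_order A" if "a \<noteq> 0"
  using that
  by (simp add: diffop_order_def times_diffop.rep_eq skew_times_def)

theorem corollary1:
  fixes d :: nat
  assumes "d \<ge> 3"
  shows "diffop_order (L_F d) = d - 1
    \<and> diffop_apply (L_F d) (fps_to_fls (F_series d)) = 0
    \<and> \<not> (\<exists>A B. L_F d = A * B \<and> diffop_order A \<ge> 1 \<and> diffop_order B \<ge> 1)"
proof (intro conjI notI)
  let ?r = "(d + 1) div 2" and ?q = "top_symbol d (Suc d)"
  define m where "m = d - 2"
  obtain \<Lambda> where \<Lambda>: "z_op * L_F d = poly_diffop \<Lambda>" by (rule z_L_F_polynomial)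
  note shape = z_L_F_shape[OF assms \<Lambda>, folded m_def]
  note ind = indicial_z_L_F[OF \<Lambda>]
  show ord: "diffop_order (L_F d) = d - 1"
    using diffop_order_of_ratfun_mult[of ratfun_var "L_F d"] diffop_order_poly_diffop[of \<Lambda>] shape(1) assms
    by (simp add: \<Lambda> m_def)
  show "diffop_apply (L_F d) (fps_to_fls (F_series d)) = 0"
    using assms by (rule L_F_annihilates_F)
  assume "\<exists>A B. L_F d = A * B \<and> diffop_order A \<ge> 1 \<and> diffop_order B \<ge> 1"
  then obtain A B where AB: "L_F d = A * B" "diffop_order A \<ge> 1" "diffop_order B \<ge> 1" by blast
  have nz: "A \<noteq> 0" "B \<noteq> 0"
    using AB(2,3) by (auto simp: diffop_order_def zero_diffop.rep_eq)
  obtain g \<beta> where g: "g \<noteq> 0" and \<beta>: "of_ratfun (to_fract g) * B = poly_diffop \<beta>"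
    by (rule clear_denominators)
  \<comment> \<open>Moving the denominator of \<open>B\<close> into \<open>A\<close> keeps the product and the orders.\<close>
  define A' where "A' = z_op * A * of_ratfun (inverse (to_fract g))"
  obtain h \<alpha> where h: "h \<noteq> 0" and \<alpha>: "of_ratfun (to_fract h) * A' = poly_diffop \<alpha>"
    by (rule clear_denominators)
  have inv: "of_ratfun (inverse (to_fract g)) * of_ratfun (to_fract g) = 1"
    using g by (simp flip: of_ratfun_mult)
  with inv have "A' * (of_ratfun (to_fract g) * B) = z_op * A * B"
    unfolding A'_def by (metis mult.assoc mult.right_neutral)
  then have "of_ratfun (to_fract h) * poly_diffop \<Lambda> = poly_diffop \<alpha> * poly_diffop \<beta>"
    unfolding \<alpha>[symmetric] \<beta>[symmetric] \<Lambda>[symmetric] AB(1) by (simp add: mult.assoc)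
  then have comp: "h * act \<Lambda> f = act \<alpha> (act \<beta> f)" for f by (rule factorization_act)
  have deg\<beta>: "degree \<beta> = diffop_order B"
    using diffop_order_of_ratfun_mult[of "to_fract g" B] g by (simp add: \<beta> diffop_order_poly_diffop)
  have deg\<alpha>: "degree \<alpha> = diffop_order A"
  proof -
    have 0: "of_ratfun (inverse (to_fract g)) \<noteq> 0"
      using inv by (metis mult_zero_left zero_neq_one)
    have "of_ratfun (inverse ratfun_var) * (z_op * A) = A"
      by (simp flip: of_ratfun_mult mult.assoc)
    then have "z_op * A \<noteq> 0" using nz(1) by (metis mult_zero_right)
    then have "diffop_order A' = diffop_order A + diffop_order (of_ratfun (inverse (to_fract g)))"
      unfolding A'_def using 0 diffop_order_of_ratfun_mult[of ratfun_var A]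
      by (simp add: diffop_order_mult)
    then have "diffop_order A' = diffop_order A" by (simp add: diffop_order_def)
    then show ?thesis
      using diffop_order_of_ratfun_mult[of "to_fract h" A'] h by (simp add: \<alpha> diffop_order_poly_diffop)
  qed
  obtain k where k: "degree \<beta> = Suc k" using deg\<beta> AB(3) by (metis Suc_le_D One_nat_def)
  have deg: "degree \<Lambda> = degree \<alpha> + Suc k"
    using diffop_order_mult[OF nz] ord shape(1) assms AB(1) k unfolding deg\<alpha> deg\<beta> m_def by simp
  have "degree \<alpha> \<ge> 1" using deg\<alpha> AB(2) by simp
  then have km: "k < m" and \<alpha>0: "\<alpha> \<noteq> 0" using deg shape(1) by auto
  have dm: "d - 1 = Suc m" using assms by (simp add: m_def)
  have R0: "R_poly d 0 = monom 1 (Suc m)" using dm by (simp add: R_poly_def)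
  have zero: "extremal 1 \<Lambda> 0" "indicial \<Lambda> 0 = monom 1 (Suc m)"
    unfolding extremal_def by (simp_all add: ind R0 split: if_splits)
  have Rr: "R_poly d ?r \<noteq> 0" by (rule sum_positive_parts_at_infinity(2)[OF assms])
  have dq: "degree ?q = ?r" using top_symbol_simple_roots(1)[of d] by simp
  have "coeff (R_poly d ?r) (Suc m) \<noteq> 0" "degree (R_poly d ?r) \<le> Suc m"
  proof -
    have "coeff ?q ?r \<noteq> 0"
      using top_symbol_simple_roots(2)[of d] by (metis dq leading_coeff_0_iff)
    moreover have "2 * ?r \<le> Suc d" by simp
    ultimately show "coeff (R_poly d ?r) (Suc m) \<noteq> 0" "degree (R_poly d ?r) \<le> Suc m"
      using R_poly_top(1,2)[of d ?r] assms unfolding dm by simp_all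
  qed
  then have degR: "degree (R_poly d ?r) = Suc m" using le_degree by (intro antisym) blast+
  have inf: "extremal (-1) \<Lambda> (int ?r)" "degree (indicial \<Lambda> (int ?r)) = Suc m"
    unfolding extremal_def ind using Rr degR by (simp_all split: if_splits)
  obtain S where S: "S \<subseteq># proots (indicial \<Lambda> (int ?r))" "size S = Suc k"
    "- (real (degree ?q) * max 0 (real k - (real m - 1) / 2)) \<le> Re (sum_mset S)"
    using fuchs_inequality[OF shape top_symbol_simple_roots(2,3) zero inf h \<alpha>0 k comp deg km]
    by blast
  have "indicial \<Lambda> (int ?r) = R_poly d ?r" by (simp add: ind)
  then show False
    using exponent_sum_contradiction[OF assms refl, of S k] S km by (simp add: dq m_def)
qed

end
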